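(* Let $\mathfrak g$ be a finite-dimensional Lie algebra over any field $\Bbbk$. Let $\mathcal H$ be any Hopf algebra such that $U(\mathfrak g)^{min}\subset\mathcal H\subset U(\mathfrak g)^\circ$. Then the non-degenerate pairing $U(\mathfrak g)\otimes\mathcal H\to\Bbbk$ induces a unique right Hopf action $\blacktriangleleft\colon U(\mathfrak g)\otimes\mathcal H\to U(\mathfrak g)$ such that $\langle D\blacktriangleleft f,h\rangle=\langle D,fh\rangle$ for all $D\in U(\mathfrak g)$ and all $f,h\in\mathcal H$, and this action induces a smash product algebra structure $\mathcal H\# U(\mathfrak g)$. Let $X_1,\dots,X_n$ be a basis of $\mathfrak g$ and let $\lambda\colon U(\mathfrak g)\to\mathcal H\# U(\mathfrak g)$ be the unique linear antimultiplicative unital map such that $\lambda(X_j)=\sum_i\bar{\mathcal U}^i_j\# X_i$ for every $j\in\{1,\dots,n\}$. Then $(U(\mathfrak g),\blacktriangleleft,\lambda)$ is a braided commutative right-left Yetter–Drinfeld module algebra over $\mathcal H$.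
   Context: $U(\mathfrak g)$ is the universal enveloping algebra and $U(\mathfrak g)^\circ\subset U(\mathfrak g)^*$ is its finite dual, with the Hopf algebra structure for which the restriction $\langle\,,\rangle\colon U(\mathfrak g)\otimes U(\mathfrak g)^\circ\to\Bbbk$ of the canonical evaluation pairing is a Hopf pairing; the pairing of $U(\mathfrak g)$ with $\mathcal H$ is its restriction. Define structure constants by $[X_i,X_j]=\sum_kC_{ij}^kX_k$. The functionals $\mathcal U^i_j,\bar{\mathcal U}^i_j\in U(\mathfrak g)^\circ$ ($1\le i,j\le n$) are the unique ones satisfying, for all $i,j,k$, $\langle X_k,\mathcal U^i_j\rangle=C^i_{kj}$, $\Delta(\mathcal U^i_j)=\sum_k\mathcal U^i_k\otimes\mathcal U^k_j$, $\Delta(\bar{\mathcal U}^i_j)=\sum_k\bar{\mathcal U}^k_j\otimes\bar{\mathcal U}^i_k$, $\epsilon(\mathcal U^i_j)=\delta^i_j=\epsilon(\bar{\mathcal U}^i_j)$, $S(\mathcal U^i_j)=\bar{\mathcal U}^i_j$, $S(\bar{\mathcal U}^i_j)=\mathcal U^i_j$. $U(\mathfrak g)^{min}$ is the subalgebra of $U(\mathfrak g)^*$ generated by all $\mathcal U^i_j,\bar{\mathcal U}^i_j$; it is a Hopf subalgebra of $U(\mathfrak g)^\circ$. A right action of a bialgebra $H$ on an algebra $A$ is Hopf if $(ab)\blacktriangleleft h=\sum(a\blacktriangleleft h_{(1)})(b\blacktriangleleft h_{(2)})$ and $1\blacktriangleleft h=\epsilon(h)1$. The smash product algebra $H\# A$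 is then $H\otimes A$ with multiplication $(h\# a)(h'\# a')=\sum hh'_{(1)}\#(a\blacktriangleleft h'_{(2)})a'$. A right-left Yetter–Drinfeld module algebra over a bialgebra $H$ is an algebra $A$ with a right Hopf action $\blacktriangleleft$ of $H$ and a left $H$-comodule structure $\lambda(a)=\sum a_{[-1]}\otimes a_{[0]}$ such that for all $a,b\in A$, $h\in H$: $\sum a_{[-1]}h_{(1)}\otimes(a_{[0]}\blacktriangleleft h_{(2)})=\sum h_{(2)}(a\blacktriangleleft h_{(1)})_{[-1]}\otimes(a\blacktriangleleft h_{(1)})_{[0]}$; $\lambda(ab)=\sum b_{[-1]}a_{[-1]}\otimes a_{[0]}b_{[0]}$; $\lambda(1)=1\otimes1$. It is braided commutative if $\sum(a\blacktriangleleft b_{[-1]})b_{[0]}=ba$ for all $a,b\in A$. The underlying space of $H\# A$ is $H\otimes A$, so $\lambda$ with values in $H\# A$ is read as a map to $H\otimes A$.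
   Formalization: Uniqueness of the action is stated only when the pairing of U(g) with H is non-degenerate, since it can fail otherwise (Heisenberg algebra, H = U(g)^min); all other claims are proved for every H, with the action given explicitly as D◁f = Σ⟨D₁,f⟩D₂. *)

theory Defs
  imports Complex_Main "HOL-Library.Function_Algebras"
begin

text \<open>
  Algebras are records with an explicit carrier, which is a linear subspace of the ambient type;
  addition is that of the type and the scalar action \<open>smul\<close> is defined on the whole type.
  On functions with values in the field (functionals, tensors) addition is pointwise.
\<close>

definition fscale :: "'k::field \<Rightarrow> ('x \<Rightarrow> 'k) \<Rightarrow> 'x \<Rightarrow> 'k"
  where "fscale c f = (\<lambda>x. c * f x)"

lemma vector_space_fscale: "vector_space (fscale :: 'k::field \<Rightarrow> ('x \<Rightarrow> 'k) \<Rightarrow> 'x \<Rightarrow> 'k)"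
  by unfold_locales (auto simp: fscale_def fun_eq_iff algebra_simps)

record ('k, 'a) algebra =
  carrier :: "'a set"
  smul :: "'k \<Rightarrow> 'a \<Rightarrow> 'a"
  mult :: "'a \<Rightarrow> 'a \<Rightarrow> 'a"
  unity :: 'a

definition linear_on_carrier ::
    "('k, 'a::ab_group_add, 'm) algebra_scheme \<Rightarrow> ('k \<Rightarrow> 'c::ab_group_add \<Rightarrow> 'c) \<Rightarrow> ('a \<Rightarrow> 'c) \<Rightarrow> bool"
  where "linear_on_carrier A s f \<longleftrightarrow>
    (\<forall>x\<in>carrier A. \<forall>y\<in>carrier A. f (x + y) = f x + f y) \<and>
    (\<forall>c. \<forall>x\<in>carrier A. f (smul A c x) = s c (f x))"

definition bilinear_on_carriers ::
    "('k, 'a::ab_group_add, 'm) algebra_scheme \<Rightarrow> ('k, 'b::ab_group_add, 'n) algebra_scheme \<Rightarrow>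
     ('k \<Rightarrow> 'c::ab_group_add \<Rightarrow> 'c) \<Rightarrow> ('a \<Rightarrow> 'b \<Rightarrow> 'c) \<Rightarrow> bool"
  where "bilinear_on_carriers A B s f \<longleftrightarrow>
    (\<forall>b\<in>carrier B. linear_on_carrier A s (\<lambda>a. f a b)) \<and>
    (\<forall>a\<in>carrier A. linear_on_carrier B s (f a))"

definition is_algebra :: "('k::field, 'a::ab_group_add, 'm) algebra_scheme \<Rightarrow> bool"
  where "is_algebra A \<longleftrightarrow>
    vector_space (smul A) \<and> module.subspace (smul A) (carrier A) \<and>
    unity A \<in> carrier A \<and>
    (\<forall>a\<in>carrier A. \<forall>b\<in>carrier A. mult A a b \<in> carrier A) \<and>
    bilinear_on_carriers A A (smul A) (mult A) \<and>
    (\<forall>a\<in>carrier A. \<forall>b\<in>carrier A. \<forall>c\<in>carrier A. mult A (mult A a b) c = mult A a (mult A b c)) \<and>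
    (\<forall>a\<in>carrier A. mult A (unity A) a = a \<and> mult A a (unity A) = a)"

definition is_subalgebra :: "'a set \<Rightarrow> ('k::field, 'a::ab_group_add, 'm) algebra_scheme \<Rightarrow> bool"
  where "is_subalgebra S A \<longleftrightarrow> S \<subseteq> carrier A \<and> is_algebra (A\<lparr>carrier := S\<rparr>)"

definition generated_subalgebra ::
    "('k::field, 'a::ab_group_add, 'm) algebra_scheme \<Rightarrow> 'a set \<Rightarrow> 'a set"
  where "generated_subalgebra A G = \<Inter> {S. is_subalgebra S A \<and> G \<subseteq> S}"


section \<open>Tensor products\<close>

text \<open>
  The tensor product over a field is realised inside the dual of the space of bilinear forms:
  \<open>a \<otimes> b\<close> is evaluation of bilinear forms at \<open>(a, b)\<close>. Since bilinear forms separate the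
  points of a tensor product over a field, and extend from subspaces, the span of the pure tensors
  with factors in the two carriers is the tensor product of the carriers.
\<close>

type_synonym ('k, 'a, 'b) tensor = "('a \<Rightarrow> 'b \<Rightarrow> 'k) \<Rightarrow> 'k"

definition bilinear_form ::
    "('k::field \<Rightarrow> 'a::ab_group_add \<Rightarrow> 'a) \<Rightarrow> ('k \<Rightarrow> 'b::ab_group_add \<Rightarrow> 'b) \<Rightarrow> ('a \<Rightarrow> 'b \<Rightarrow> 'k) \<Rightarrow> bool"
  where "bilinear_form sa sb \<beta> \<longleftrightarrow>
    (\<forall>b. Vector_Spaces.linear sa (*) (\<lambda>a. \<beta> a b)) \<and> (\<forall>a. Vector_Spaces.linear sb (*) (\<beta> a))"

definition tens ::
    "('k::field, 'a::ab_group_add, 'm) algebra_scheme \<Rightarrow> ('k, 'b::ab_group_add, 'n) algebra_scheme \<Rightarrow>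
     'a \<Rightarrow> 'b \<Rightarrow> ('k, 'a, 'b) tensor"
  where "tens A B a b = (\<lambda>\<beta>. if bilinear_form (smul A) (smul B) \<beta> then \<beta> a b else 0)"

definition tensor_space ::
    "('k::field, 'a::ab_group_add, 'm) algebra_scheme \<Rightarrow> ('k, 'b::ab_group_add, 'n) algebra_scheme \<Rightarrow>
     ('k, 'a, 'b) tensor set"
  where "tensor_space A B =
    module.span fscale {tens A B a b | a b. a \<in> carrier A \<and> b \<in> carrier B}"

text \<open>
  \<open>sweedler A B \<phi> t\<close> is the value \<open>\<Sum> \<phi> t\<^sub>1 t\<^sub>2\<close> of the linear map on the tensor product
  induced by a bilinear \<open>\<phi>\<close>. It depends on \<open>\<phi>\<close> being bilinear on the carriers only;
  independence of the representation of \<open>t\<close> is lemma \<open>sweedler_sum\<close> below.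
\<close>

definition sweedler ::
    "('k::field, 'a::ab_group_add, 'm) algebra_scheme \<Rightarrow> ('k, 'b::ab_group_add, 'n) algebra_scheme \<Rightarrow>
     ('a \<Rightarrow> 'b \<Rightarrow> 'c::ab_group_add) \<Rightarrow> ('k, 'a, 'b) tensor \<Rightarrow> 'c"
  where "sweedler A B \<phi> t = (THE z. \<exists>(m::nat) a b.
    (\<forall>i<m. a i \<in> carrier A \<and> b i \<in> carrier B) \<and>
    t = (\<Sum>i<m. tens A B (a i) (b i)) \<and> z = (\<Sum>i<m. \<phi> (a i) (b i)))"

lemma projection_onto_subspace:
  assumes "vector_space s" and "module.subspace s V"
  obtains p where "Vector_Spaces.linear s s p" "\<And>x. x \<in> V \<Longrightarrow> p x = x" "\<And>x. p x \<in> V"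
proof -
  interpret vector_space s by fact
  interpret vector_space_pair s s by unfold_locales
  obtain B where B: "B \<subseteq> V" "independent B" "V \<subseteq> span B"
    using maximal_independent_subset[of V] by blast
  have VB: "span B = V" using B assms(2) span_minimal[of B V] by blast
  obtain p where p: "Vector_Spaces.linear s s p" "\<forall>x\<in>B. p x = id x" "range p = span (id ` B)"
    using linear_independent_extend_subspace[OF B(2), of id] by blast
  have "p x = x" if "x \<in> V" for x
    using linear_eq_on[OF p(1) linear_id, of x B] p(2) that VB by auto
  moreover have "p x \<in> V" for x using p(3) VB by auto
  ultimately show ?thesis using that p(1) by blast
qed

lemma separating_functional:
  assumes "vector_space s" and "z \<noteq> 0"
  obtains \<psi> :: "'c::ab_group_add \<Rightarrow> 'k::field"
    where "Vector_Spaces.linear s (*) \<psi>" "\<psi> z \<noteq> 0"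
proof -
  interpret vector_space s by fact
  interpret vector_space_pair s "(*) :: 'k \<Rightarrow> 'k \<Rightarrow> 'k"
    by unfold_locales (auto simp: algebra_simps)
  have "independent {z}" using assms(2) by simp
  then show ?thesis
    using linear_independent_extend[of "{z}" "\<lambda>_. 1"] that by fastforce
qed

lemma sweedler_sum:
  fixes s :: "'k::field \<Rightarrow> 'c::ab_group_add \<Rightarrow> 'c"
  assumes A: "vector_space (smul A)" "module.subspace (smul A) (carrier A)"
    and B: "vector_space (smul B)" "module.subspace (smul B) (carrier B)"
    and s: "vector_space s" and \<phi>: "bilinear_on_carriers A B s \<phi>"
    and ab: "\<And>i. i < m \<Longrightarrow> a i \<in> carrier A \<and> b i \<in> carrier B"
  shows "sweedler A B \<phi> (\<Sum>i<m. tens A B (a i) (b i)) = (\<Sum>i<(m::nat). \<phi> (a i) (b i))"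
  unfolding sweedler_def
proof (rule the_equality, goal_cases)
  case 1
  show ?case using ab by blast
next
  case (2 z)
  then obtain m' :: nat and a' b' where ab': "\<forall>i<m'. a' i \<in> carrier A \<and> b' i \<in> carrier B"
    and eq: "(\<Sum>i<m. tens A B (a i) (b i)) = (\<Sum>i<m'. tens A B (a' i) (b' i))"
    and z: "z = (\<Sum>i<m'. \<phi> (a' i) (b' i))" by blast
  show "z = (\<Sum>i<m. \<phi> (a i) (b i))"
  proof (rule ccontr)
    assume "z \<noteq> (\<Sum>i<m. \<phi> (a i) (b i))"
    then have "z - (\<Sum>i<m. \<phi> (a i) (b i)) \<noteq> 0" by simp
    from separating_functional[OF s this]
    obtain \<psi> :: "'c \<Rightarrow> 'k" where \<psi>: "Vector_Spaces.linear s (*) \<psi>"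
        and ne: "\<psi> (z - (\<Sum>i<m. \<phi> (a i) (b i))) \<noteq> 0" .
    obtain p where p: "Vector_Spaces.linear (smul A) (smul A) p"
        "\<And>x. x \<in> carrier A \<Longrightarrow> p x = x" "\<And>x. p x \<in> carrier A"
      using projection_onto_subspace[OF A] by metis
    obtain q where q: "Vector_Spaces.linear (smul B) (smul B) q"
        "\<And>x. x \<in> carrier B \<Longrightarrow> q x = x" "\<And>x. q x \<in> carrier B"
      using projection_onto_subspace[OF B] by metis
    interpret P: Vector_Spaces.linear "smul A" "smul A" p by fact
    interpret Q: Vector_Spaces.linear "smul B" "smul B" q by fact
    interpret L: Vector_Spaces.linear s "(*)" \<psi> by fact
    define \<beta> where "\<beta> = (\<lambda>x y. \<psi> (\<phi> (p x) (q y)))"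
    have bf: "bilinear_form (smul A) (smul B) \<beta>"
      unfolding bilinear_form_def Vector_Spaces.linear_def module_hom_iff
      using \<phi> p(3) q(3) A(1) B(1) L.vs2.vector_space_axioms
        P.vs1.module_axioms Q.vs1.module_axioms L.vs2.module_axioms
      by (simp add: \<beta>_def bilinear_on_carriers_def linear_on_carrier_def
          P.add P.scale Q.add Q.scale L.add L.scale)
    have tens_\<beta>: "tens A B c d \<beta> = \<psi> (\<phi> c d)" if "c \<in> carrier A" "d \<in> carrier B" for c d
      unfolding tens_def using bf that by (simp add: p(2) q(2)) (simp add: \<beta>_def p(2) q(2))
    have ev: "(\<Sum>i<k. tens A B (c i) (d i)) \<beta> = \<psi> (\<Sum>i<k. \<phi> (c i) (d i))"
      if "\<forall>i<k. c i \<in> carrier A \<and> d i \<in> carrier B" for k :: nat and c d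
      using that
      by (induction k) (simp_all add: L.add tens_\<beta>)
    have "\<psi> z = \<psi> (\<Sum>i<m. \<phi> (a i) (b i))"
      using ev[of m a b] ev[of m' a' b'] ab ab' eq z by simp
    then show False using ne by (simp add: L.diff)
  qed
qed

definition tensor_algebra ::
    "('k::field, 'a::ab_group_add, 'm) algebra_scheme \<Rightarrow> ('k, 'b::ab_group_add, 'n) algebra_scheme \<Rightarrow>
     ('k, ('k, 'a, 'b) tensor) algebra"
  where "tensor_algebra A B = \<lparr>
    carrier = tensor_space A B,
    smul = fscale,
    mult = (\<lambda>s t. sweedler A B (\<lambda>a b. sweedler A B (\<lambda>a' b'.
              tens A B (mult A a a') (mult B b b')) t) s),
    unity = tens A B (unity A) (unity B)\<rparr>"


section \<open>Bialgebras and Hopf algebras\<close>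

record ('k, 'a) hopf = "('k, 'a) algebra" +
  comult :: "'a \<Rightarrow> ('k, 'a, 'a) tensor"
  counit :: "'a \<Rightarrow> 'k"
  antipode :: "'a \<Rightarrow> 'a"

definition is_bialgebra :: "('k::field, 'a::ab_group_add, 'm) hopf_scheme \<Rightarrow> bool"
  where "is_bialgebra H \<longleftrightarrow>
    is_algebra H \<and>
    (\<forall>x\<in>carrier H. comult H x \<in> tensor_space H H) \<and>
    linear_on_carrier H fscale (comult H) \<and>
    linear_on_carrier H (*) (counit H) \<and>
    (\<forall>x\<in>carrier H.
      sweedler H H (\<lambda>a b. sweedler H H (\<lambda>a1 a2.
          tens H (tensor_algebra H H) a1 (tens H H a2 b)) (comult H a)) (comult H x)
      = sweedler H H (\<lambda>a b. tens H (tensor_algebra H H) a (comult H b)) (comult H x)) \<and>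
    (\<forall>x\<in>carrier H.
      sweedler H H (\<lambda>a b. smul H (counit H a) b) (comult H x) = x \<and>
      sweedler H H (\<lambda>a b. smul H (counit H b) a) (comult H x) = x) \<and>
    (\<forall>x\<in>carrier H. \<forall>y\<in>carrier H.
      comult H (mult H x y) = mult (tensor_algebra H H) (comult H x) (comult H y) \<and>
      counit H (mult H x y) = counit H x * counit H y) \<and>
    comult H (unity H) = tens H H (unity H) (unity H) \<and>
    counit H (unity H) = 1"

definition is_hopf_algebra :: "('k::field, 'a::ab_group_add, 'm) hopf_scheme \<Rightarrow> bool"
  where "is_hopf_algebra H \<longleftrightarrow>
    is_bialgebra H \<and>
    (\<forall>x\<in>carrier H. antipode H x \<in> carrier H) \<and>
    linear_on_carrier H (smul H) (antipode H) \<and>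
    (\<forall>x\<in>carrier H.
      sweedler H H (\<lambda>a b. mult H (antipode H a) b) (comult H x) = smul H (counit H x) (unity H) \<and>
      sweedler H H (\<lambda>a b. mult H a (antipode H b)) (comult H x) = smul H (counit H x) (unity H))"

definition is_hopf_subalgebra :: "'a set \<Rightarrow> ('k::field, 'a::ab_group_add, 'm) hopf_scheme \<Rightarrow> bool"
  where "is_hopf_subalgebra S H \<longleftrightarrow> S \<subseteq> carrier H \<and> is_hopf_algebra (H\<lparr>carrier := S\<rparr>)"


section \<open>Lie algebras and universal enveloping algebras\<close>

definition is_lie_algebra ::
    "('k::field \<Rightarrow> 'g::ab_group_add \<Rightarrow> 'g) \<Rightarrow> ('g \<Rightarrow> 'g \<Rightarrow> 'g) \<Rightarrow> bool"
  where "is_lie_algebra sg br \<longleftrightarrow>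
    vector_space sg \<and>
    (\<forall>x. Vector_Spaces.linear sg sg (br x)) \<and>
    (\<forall>y. Vector_Spaces.linear sg sg (\<lambda>x. br x y)) \<and>
    (\<forall>x. br x x = 0) \<and>
    (\<forall>x y z. br x (br y z) + br y (br z x) + br z (br x y) = 0)"

definition is_basis :: "('k::field \<Rightarrow> 'g::ab_group_add \<Rightarrow> 'g) \<Rightarrow> nat \<Rightarrow> (nat \<Rightarrow> 'g) \<Rightarrow> bool"
  where "is_basis sg n X \<longleftrightarrow>
    inj_on X {1..n} \<and> \<not> module.dependent sg (X ` {1..n}) \<and> module.span sg (X ` {1..n}) = UNIV"

text \<open>
  The free associative algebra on the set underlying \<open>\<gg>\<close> has the words in \<open>\<gg>\<close> as a linear
  basis; its elements are the finitely supported functions on words. Dividing out the two-sided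
  ideal spanned by the first two families of relations gives the tensor algebra \<open>T(\<gg>)\<close>, and the
  third family then gives \<open>U(\<gg>) = T(\<gg>) / (x \<otimes> y - y \<otimes> x - [x, y])\<close>.
\<close>

definition word :: "'g list \<Rightarrow> 'g list \<Rightarrow> 'k::field"
  where "word w = (\<lambda>v. if v = w then 1 else 0)"

definition free_algebra :: "('g list \<Rightarrow> 'k::field) set"
  where "free_algebra = {p. finite {w. p w \<noteq> 0}}"

definition eval_free ::
    "('k::field, 'u::ab_group_add, 'm) algebra_scheme \<Rightarrow> ('g \<Rightarrow> 'u) \<Rightarrow> ('g list \<Rightarrow> 'k) \<Rightarrow> 'u"
  where "eval_free U \<iota> p =
    (\<Sum>w | p w \<noteq> 0. smul U (p w) (foldr (\<lambda>x. mult U (\<iota> x)) w (unity U)))"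

definition enveloping_ideal ::
    "('k::field \<Rightarrow> 'g::ab_group_add \<Rightarrow> 'g) \<Rightarrow> ('g \<Rightarrow> 'g \<Rightarrow> 'g) \<Rightarrow> ('g list \<Rightarrow> 'k) set"
  where "enveloping_ideal sg br = module.span fscale (
    {word (u @ [x + y] @ v) - word (u @ [x] @ v) - word (u @ [y] @ v) | u v x y. True} \<union>
    {word (u @ [sg c x] @ v) - fscale c (word (u @ [x] @ v)) | u v c x. True} \<union>
    {word (u @ [x, y] @ v) - word (u @ [y, x] @ v) - word (u @ [br x y] @ v) | u v x y. True})"

text \<open>
  The algebra \<open>U\<close> with \<open>\<iota> : \<gg> \<rightarrow> U\<close> is (up to isomorphism) the universal enveloping algebra:
  the map from the free algebra is onto, with kernel the ideal above. Its carrier is a whole type,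
  so that the dual space consists of ordinary linear functions. The Hopf structure is the one with
  primitive elements of \<open>\<gg>\<close>, which determines the counit and the antipode.
\<close>

definition is_universal_enveloping ::
    "('k::field \<Rightarrow> 'g::ab_group_add \<Rightarrow> 'g) \<Rightarrow> ('g \<Rightarrow> 'g \<Rightarrow> 'g) \<Rightarrow>
     ('k, 'u::ab_group_add, 'm) algebra_scheme \<Rightarrow> ('g \<Rightarrow> 'u) \<Rightarrow> bool"
  where "is_universal_enveloping sg br U \<iota> \<longleftrightarrow>
    is_algebra U \<and> carrier U = UNIV \<and>
    eval_free U \<iota> ` free_algebra = UNIV \<and>
    {p \<in> free_algebra. eval_free U \<iota> p = 0} = enveloping_ideal sg br"

definition is_enveloping_hopf_algebra ::
    "('k::field \<Rightarrow> 'g::ab_group_add \<Rightarrow> 'g) \<Rightarrow> ('g \<Rightarrow> 'g \<Rightarrow> 'g) \<Rightarrow>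
     ('k, 'u::ab_group_add, 'm) hopf_scheme \<Rightarrow> ('g \<Rightarrow> 'u) \<Rightarrow> bool"
  where "is_enveloping_hopf_algebra sg br U \<iota> \<longleftrightarrow>
    is_universal_enveloping sg br U \<iota> \<and> is_hopf_algebra U \<and>
    (\<forall>x. comult U (\<iota> x) = tens U U (\<iota> x) (unity U) + tens U U (unity U) (\<iota> x))"


section \<open>The dual algebra and the finite dual\<close>

definition dual_algebra ::
    "('k::field, 'u::ab_group_add, 'm) hopf_scheme \<Rightarrow> ('k, 'u \<Rightarrow> 'k) algebra"
  where "dual_algebra U = \<lparr>
    carrier = {f. Vector_Spaces.linear (smul U) (*) f},
    smul = fscale,
    mult = (\<lambda>f h D. sweedler U U (\<lambda>D1 D2. f D1 * h D2) (comult U D)),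
    unity = counit U\<rparr>"

definition is_ideal :: "('k::field, 'u::ab_group_add, 'm) algebra_scheme \<Rightarrow> 'u set \<Rightarrow> bool"
  where "is_ideal U I \<longleftrightarrow>
    I \<subseteq> carrier U \<and> module.subspace (smul U) I \<and>
    (\<forall>a\<in>carrier U. \<forall>x\<in>I. mult U a x \<in> I \<and> mult U x a \<in> I)"

text \<open>
  The functionals vanishing on an ideal of finite codimension, with the Hopf structure for which
  evaluation is a Hopf pairing; in particular \<open>\<langle>D D', f\<rangle> = \<Sum> \<langle>D, f\<^sub>1\<rangle> \<langle>D', f\<^sub>2\<rangle>\<close>.
\<close>

definition finite_dual ::
    "('k::field, 'u::ab_group_add, 'm) hopf_scheme \<Rightarrow> ('k, 'u \<Rightarrow> 'k) hopf"
  where "finite_dual U = \<lparr>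
    carrier = {f \<in> carrier (dual_algebra U). \<exists>I B. is_ideal U I \<and> finite B \<and>
                 module.span (smul U) (I \<union> B) = carrier U \<and> (\<forall>x\<in>I. f x = 0)},
    smul = smul (dual_algebra U),
    mult = mult (dual_algebra U),
    unity = unity (dual_algebra U),
    comult = (\<lambda>f. THE t. t \<in> tensor_space (dual_algebra U) (dual_algebra U) \<and>
                (\<forall>D D'. f (mult U D D') =
                   sweedler (dual_algebra U) (dual_algebra U) (\<lambda>f1 f2. f1 D * f2 D') t)),
    counit = (\<lambda>f. f (unity U)),
    antipode = (\<lambda>f D. f (antipode U D))\<rparr>"

text \<open>
  \<open>C i j k\<close> is \<open>C\<^sub>i\<^sub>j\<^sup>k\<close>; \<open>Um i j\<close> and \<open>Ub i j\<close> are the functionals with upper index \<open>i\<close> and lower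
  index \<open>j\<close>, the second one being the barred one.
\<close>

definition structure_constants ::
    "('k::field \<Rightarrow> 'g::ab_group_add \<Rightarrow> 'g) \<Rightarrow> ('g \<Rightarrow> 'g \<Rightarrow> 'g) \<Rightarrow> nat \<Rightarrow> (nat \<Rightarrow> 'g) \<Rightarrow>
     (nat \<Rightarrow> nat \<Rightarrow> nat \<Rightarrow> 'k) \<Rightarrow> bool"
  where "structure_constants sg br n X C \<longleftrightarrow>
    (\<forall>i\<in>{1..n}. \<forall>j\<in>{1..n}. br (X i) (X j) = (\<Sum>k=1..n. sg (C i j k) (X k)))"

definition adjoint_functionals ::
    "('k::field, 'u::ab_group_add, 'm) hopf_scheme \<Rightarrow> ('g \<Rightarrow> 'u) \<Rightarrow> nat \<Rightarrow> (nat \<Rightarrow> 'g) \<Rightarrow>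
     (nat \<Rightarrow> nat \<Rightarrow> nat \<Rightarrow> 'k) \<Rightarrow> (nat \<Rightarrow> nat \<Rightarrow> 'u \<Rightarrow> 'k) \<Rightarrow> (nat \<Rightarrow> nat \<Rightarrow> 'u \<Rightarrow> 'k) \<Rightarrow> bool"
  where "adjoint_functionals U \<iota> n X C Um Ub \<longleftrightarrow> (let F = finite_dual U in
    \<forall>i\<in>{1..n}. \<forall>j\<in>{1..n}.
      Um i j \<in> carrier F \<and> Ub i j \<in> carrier F \<and>
      (\<forall>k\<in>{1..n}. Um i j (\<iota> (X k)) = C k j i) \<and>
      comult F (Um i j) = (\<Sum>k=1..n. tens F F (Um i k) (Um k j)) \<and>
      comult F (Ub i j) = (\<Sum>k=1..n. tens F F (Ub k j) (Ub i k)) \<and>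
      counit F (Um i j) = (if i = j then 1 else 0) \<and>
      counit F (Ub i j) = (if i = j then 1 else 0) \<and>
      antipode F (Um i j) = Ub i j \<and>
      antipode F (Ub i j) = Um i j)"

definition enveloping_min ::
    "('k::field, 'u::ab_group_add, 'm) hopf_scheme \<Rightarrow> nat \<Rightarrow>
     (nat \<Rightarrow> nat \<Rightarrow> 'u \<Rightarrow> 'k) \<Rightarrow> (nat \<Rightarrow> nat \<Rightarrow> 'u \<Rightarrow> 'k) \<Rightarrow> ('u \<Rightarrow> 'k) set"
  where "enveloping_min U n Um Ub = generated_subalgebra (dual_algebra U)
    ({Um i j | i j. i \<in> {1..n} \<and> j \<in> {1..n}} \<union> {Ub i j | i j. i \<in> {1..n} \<and> j \<in> {1..n}})"

definition nondegenerate_pairing ::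
    "('k::field, 'u::ab_group_add, 'm) algebra_scheme \<Rightarrow> ('k, 'u \<Rightarrow> 'k, 'n) algebra_scheme \<Rightarrow> bool"
  where "nondegenerate_pairing U H \<longleftrightarrow>
    (\<forall>D\<in>carrier U. (\<forall>h\<in>carrier H. h D = 0) \<longrightarrow> D = 0) \<and>
    (\<forall>h\<in>carrier H. (\<forall>D\<in>carrier U. h D = 0) \<longrightarrow> h = 0)"


section \<open>Hopf actions, smash products, Yetter-Drinfeld module algebras\<close>

definition is_right_action ::
    "('k::field, 'a::ab_group_add, 'm) algebra_scheme \<Rightarrow> ('k, 'h::ab_group_add, 'n) algebra_scheme \<Rightarrow>
     ('a \<Rightarrow> 'h \<Rightarrow> 'a) \<Rightarrow> bool"
  where "is_right_action A H act \<longleftrightarrow>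
    bilinear_on_carriers A H (smul A) act \<and>
    (\<forall>a\<in>carrier A. \<forall>h\<in>carrier H. act a h \<in> carrier A) \<and>
    (\<forall>a\<in>carrier A. act a (unity H) = a) \<and>
    (\<forall>a\<in>carrier A. \<forall>h\<in>carrier H. \<forall>h'\<in>carrier H. act (act a h) h' = act a (mult H h h'))"

definition is_right_hopf_action ::
    "('k::field, 'a::ab_group_add, 'm) algebra_scheme \<Rightarrow> ('k, 'h::ab_group_add, 'n) hopf_scheme \<Rightarrow>
     ('a \<Rightarrow> 'h \<Rightarrow> 'a) \<Rightarrow> bool"
  where "is_right_hopf_action A H act \<longleftrightarrow>
    is_right_action A H act \<and>
    (\<forall>a\<in>carrier A. \<forall>b\<in>carrier A. \<forall>h\<in>carrier H.
      act (mult A a b) h = sweedler H H (\<lambda>h1 h2. mult A (act a h1) (act b h2)) (comult H h)) \<and>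
    (\<forall>h\<in>carrier H. act (unity A) h = smul A (counit H h) (unity A))"

definition smash_product ::
    "('k::field, 'h::ab_group_add, 'n) hopf_scheme \<Rightarrow> ('k, 'a::ab_group_add, 'm) algebra_scheme \<Rightarrow>
     ('a \<Rightarrow> 'h \<Rightarrow> 'a) \<Rightarrow> ('k, ('k, 'h, 'a) tensor) algebra"
  where "smash_product H A act = \<lparr>
    carrier = tensor_space H A,
    smul = fscale,
    mult = (\<lambda>s t. sweedler H A (\<lambda>h a. sweedler H A (\<lambda>h' a'.
              sweedler H H (\<lambda>h1 h2. tens H A (mult H h h1) (mult A (act a h2) a')) (comult H h'))
            t) s),
    unity = tens H A (unity H) (unity A)\<rparr>"

definition is_left_comodule ::
    "('k::field, 'h::ab_group_add, 'n) hopf_scheme \<Rightarrow> ('k, 'a::ab_group_add, 'm) algebra_scheme \<Rightarrow>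
     ('a \<Rightarrow> ('k, 'h, 'a) tensor) \<Rightarrow> bool"
  where "is_left_comodule H A lam \<longleftrightarrow>
    (\<forall>a\<in>carrier A. lam a \<in> tensor_space H A) \<and>
    linear_on_carrier A fscale lam \<and>
    (\<forall>a\<in>carrier A.
      sweedler H A (\<lambda>h b. sweedler H H (\<lambda>h1 h2.
          tens H (tensor_algebra H A) h1 (tens H A h2 b)) (comult H h)) (lam a)
      = sweedler H A (\<lambda>h b. tens H (tensor_algebra H A) h (lam b)) (lam a)) \<and>
    (\<forall>a\<in>carrier A. sweedler H A (\<lambda>h b. smul A (counit H h) b) (lam a) = a)"

definition is_yetter_drinfeld_module_algebra ::
    "('k::field, 'h::ab_group_add, 'n) hopf_scheme \<Rightarrow> ('k, 'a::ab_group_add, 'm) algebra_scheme \<Rightarrow>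
     ('a \<Rightarrow> 'h \<Rightarrow> 'a) \<Rightarrow> ('a \<Rightarrow> ('k, 'h, 'a) tensor) \<Rightarrow> bool"
  where "is_yetter_drinfeld_module_algebra H A act lam \<longleftrightarrow>
    is_bialgebra H \<and> is_algebra A \<and>
    is_right_hopf_action A H act \<and> is_left_comodule H A lam \<and>
    (\<forall>a\<in>carrier A. \<forall>h\<in>carrier H.
      sweedler H A (\<lambda>a1 a0. sweedler H H (\<lambda>h1 h2.
          tens H A (mult H a1 h1) (act a0 h2)) (comult H h)) (lam a)
      = sweedler H H (\<lambda>h1 h2. sweedler H A (\<lambda>a1 a0.
          tens H A (mult H h2 a1) a0) (lam (act a h1))) (comult H h)) \<and>
    (\<forall>a\<in>carrier A. \<forall>b\<in>carrier A.
      lam (mult A a b) = sweedler H A (\<lambda>a1 a0. sweedler H A (\<lambda>b1 b0.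
          tens H A (mult H b1 a1) (mult A a0 b0)) (lam b)) (lam a)) \<and>
    lam (unity A) = tens H A (unity H) (unity A)"

definition is_braided_commutative ::
    "('k::field, 'h::ab_group_add, 'n) hopf_scheme \<Rightarrow> ('k, 'a::ab_group_add, 'm) algebra_scheme \<Rightarrow>
     ('a \<Rightarrow> 'h \<Rightarrow> 'a) \<Rightarrow> ('a \<Rightarrow> ('k, 'h, 'a) tensor) \<Rightarrow> bool"
  where "is_braided_commutative H A act lam \<longleftrightarrow>
    (\<forall>a\<in>carrier A. \<forall>b\<in>carrier A.
      sweedler H A (\<lambda>b1 b0. mult A (act a b1) b0) (lam b) = mult A b a)"

definition is_unital_antihom ::
    "('k::field, 'a::ab_group_add, 'm) algebra_scheme \<Rightarrow> ('k, 'b::ab_group_add, 'n) algebra_scheme \<Rightarrow>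
     ('a \<Rightarrow> 'b) \<Rightarrow> bool"
  where "is_unital_antihom A B f \<longleftrightarrow>
    (\<forall>a\<in>carrier A. f a \<in> carrier B) \<and>
    linear_on_carrier A (smul B) f \<and>
    (\<forall>a\<in>carrier A. \<forall>b\<in>carrier A. f (mult A a b) = mult B (f b) (f a)) \<and>
    f (unity A) = unity B"

text \<open>
  The action obtained from the pairing, \<open>D \<triangleleft> f = \<Sum> \<langle>D\<^sub>1, f\<rangle> D\<^sub>2\<close>. If the pairing of \<open>U\<close> with a Hopf
  subalgebra of the finite dual is non-degenerate, it is the only solution of
  \<open>\<langle>D \<triangleleft> f, h\<rangle> = \<langle>D, f h\<rangle>\<close>; without non-degeneracy on the side of \<open>U\<close> other right Hopf actions
  may solve this equation.
\<close>

definition induced_action ::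
    "('k::field, 'u::ab_group_add, 'm) hopf_scheme \<Rightarrow> 'u \<Rightarrow> ('u \<Rightarrow> 'k) \<Rightarrow> 'u"
  where "induced_action U D f = sweedler U U (\<lambda>D1 D2. smul U (f D1) D2) (comult U D)"

definition action_dual_to_mult ::
    "('k::field, 'u::ab_group_add, 'm) algebra_scheme \<Rightarrow> ('k, 'u \<Rightarrow> 'k, 'n) algebra_scheme \<Rightarrow>
     ('u \<Rightarrow> ('u \<Rightarrow> 'k) \<Rightarrow> 'u) \<Rightarrow> bool"
  where "action_dual_to_mult U H act \<longleftrightarrow>
    (\<forall>D\<in>carrier U. \<forall>f\<in>carrier H. \<forall>h\<in>carrier H. h (act D f) = (mult H f h) D)"

end

theory Submission
  imports Defs
begin

text \<open>
  Everything is read off from one representation. A tensor \<open>t = \<Sum> h \<otimes> a\<close> in \<open>H \<otimes> U(\<gg>)\<close> acts on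
  \<open>U(\<gg>)\<close> by the operator \<open>D \<mapsto> \<Sum> (D \<triangleleft> h) a\<close>. For every Hopf action, the smash product is made such
  that operators compose in the opposite order (\<open>operator_smash_mult\<close>). If the representation is
  faithful, the smash product is therefore an associative algebra, and equations between tensors
  can be checked on operators.

  Braided commutativity of \<open>\<lambda>\<close> says precisely that the operator of \<open>\<lambda>(a)\<close> is left multiplication by
  \<open>a\<close>. Left multiplication by \<open>a b\<close> is the composition of those by \<open>b\<close> and \<open>a\<close>, and passing to operators
  reverses products, so such a \<open>\<lambda>\<close> is an antihomomorphism. It exists if left multiplication by each
  generator is the operator of some tensor, and every antihomomorphism with these values on the
  generators agrees with it. Counitality, coassociativity and the two compatibilities of a Yetter-Drinfeld
  module algebra hold because both sides have the same (multilinear) operators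
  (\<open>yetter_drinfeld_module_algebra\<close>).

  Two facts about \<open>U(\<gg>)\<close> remain, both proved by induction over words in \<open>\<gg>\<close>. First, the representation is faithful
  (\<open>operator_faithful\<close>): Leibniz' rule \<open>(x D) \<triangleleft> f = D \<triangleleft> f(x \<cdot>) + x (D \<triangleleft> f)\<close> allows to move the functionals
  along words until they are evaluated. Second, \<open>\<Sum>\<^sub>i \<U>\<^sup>i\<^sub>j \<otimes> X\<^sub>i\<close>, with the barred functionals
  \<open>\<U>\<^sup>i\<^sub>j\<close>, has left multiplication by \<open>X\<^sub>j\<close> as its operator (\<open>act_Ub_iota\<close>), because these
  functionals take the values \<open>-C\<^sub>k\<^sub>j\<^sup>i\<close> on \<open>X\<^sub>k\<close> and \<open>X\<^sub>k X\<^sub>j - [X\<^sub>k, X\<^sub>j] = X\<^sub>j X\<^sub>k\<close>.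

  That \<open>D \<triangleleft> f = \<Sum> f(D\<^sub>1) D\<^sub>2\<close> is a Hopf action rests on the equation
  \<open>f(D D') = \<Sum> f\<^sub>1(D) f\<^sub>2(D')\<close>, for which \<open>\<Delta>(f)\<close> has to be shown to exist as a tensor of
  functionals and to be unique (\<open>finite_dual_comult\<close>).
\<close>


section \<open>Tensor calculus on carriers\<close>

definition carrier_space :: "('k::field, 'a::ab_group_add, 'm) algebra_scheme \<Rightarrow> bool"
  where "carrier_space A \<longleftrightarrow> vector_space (smul A) \<and> module.subspace (smul A) (carrier A)"

lemma carrier_space_vector_space: "carrier_space A \<Longrightarrow> vector_space (smul A)"
  by (simp add: carrier_space_def)

lemma carrier_space_0: "carrier_space A \<Longrightarrow> 0 \<in> carrier A"
  and carrier_space_add: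
    "carrier_space A \<Longrightarrow> x \<in> carrier A \<Longrightarrow> y \<in> carrier A \<Longrightarrow> x + y \<in> carrier A"
  and carrier_space_smul: "carrier_space A \<Longrightarrow> x \<in> carrier A \<Longrightarrow> smul A c x \<in> carrier A"
  and carrier_space_minus:
    "carrier_space A \<Longrightarrow> x \<in> carrier A \<Longrightarrow> y \<in> carrier A \<Longrightarrow> x - y \<in> carrier A"
  unfolding carrier_space_def module_iff_vector_space[symmetric]
  by (blast intro: module.subspace_0 module.subspace_add module.subspace_scale
      module.subspace_diff)+

lemma carrier_space_sum:
  "carrier_space A \<Longrightarrow> (\<And>i. i \<in> I \<Longrightarrow> f i \<in> carrier A) \<Longrightarrow> (\<Sum>i\<in>I. f i) \<in> carrier A"
  by (induction I rule: infinite_finite_induct) (auto intro: carrier_space_0 carrier_space_add)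

lemma linear_on_carrierI:
  assumes "\<And>x y. x \<in> carrier A \<Longrightarrow> y \<in> carrier A \<Longrightarrow> f (x + y) = f x + f y"
    and "\<And>c x. x \<in> carrier A \<Longrightarrow> f (smul A c x) = s c (f x)"
  shows "linear_on_carrier A s f"
  using assms by (simp add: linear_on_carrier_def)

lemma bilinear_on_carriersI:
  assumes "\<And>b. b \<in> carrier B \<Longrightarrow> linear_on_carrier A s (\<lambda>a. f a b)"
    and "\<And>a. a \<in> carrier A \<Longrightarrow> linear_on_carrier B s (\<lambda>b. f a b)"
  shows "bilinear_on_carriers A B s f"
  using assms by (simp add: bilinear_on_carriers_def)

lemma linear_on_carrier_add:
  "linear_on_carrier A s f \<Longrightarrow> x \<in> carrier A \<Longrightarrow> y \<in> carrier A \<Longrightarrow> f (x + y) = f x + f y"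
  and linear_on_carrier_smul:
  "linear_on_carrier A s f \<Longrightarrow> x \<in> carrier A \<Longrightarrow> f (smul A c x) = s c (f x)"
  by (simp_all add: linear_on_carrier_def)

lemma linear_on_carrier_0:
  assumes "carrier_space A" "linear_on_carrier A s f"
  shows "f 0 = 0"
  using linear_on_carrier_add[OF assms(2), of 0 0] carrier_space_0[OF assms(1)] by simp

lemma linear_on_carrier_minus:
  assumes "carrier_space A" "linear_on_carrier A s f" "x \<in> carrier A" "y \<in> carrier A"
  shows "f (x - y) = f x - f y"
  using linear_on_carrier_add[OF assms(2), of "x - y" y] carrier_space_minus[OF assms(1)] assms(3,4)
  by (simp add: algebra_simps)

lemma linear_on_carrier_sum:
  assumes "carrier_space A" "linear_on_carrier A s f" "\<And>i. i \<in> I \<Longrightarrow> x i \<in> carrier A"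
  shows "f (\<Sum>i\<in>I. x i) = (\<Sum>i\<in>I. f (x i))"
  using assms(3)
  by (induction I rule: infinite_finite_induct)
    (auto simp: linear_on_carrier_0[OF assms(1,2)] linear_on_carrier_add[OF assms(2)]
      carrier_space_sum[OF assms(1)])

lemma linear_on_carrier_sumI:
  fixes s :: "'k::field \<Rightarrow> 'c::ab_group_add \<Rightarrow> 'c"
  assumes "vector_space s" "\<And>i. i \<in> I \<Longrightarrow> linear_on_carrier A s (f i)"
  shows "linear_on_carrier A s (\<lambda>x. \<Sum>i\<in>I. f i x)"
proof -
  interpret vector_space s by fact
  show ?thesis using assms(2)
    by (auto intro!: linear_on_carrierI simp: linear_on_carrier_def sum.distrib scale_sum_right)
qed

lemma
  fixes A :: "('k::field, 'a::ab_group_add, 'm) algebra_scheme"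
    and B :: "('k, 'b::ab_group_add, 'n) algebra_scheme"
  shows tens_add_left: "tens A B (x + y) b = tens A B x b + tens A B y b"
  and tens_smul_left: "tens A B (smul A c x) b = fscale c (tens A B x b)"
  and tens_add_right: "tens A B a (u + v) = tens A B a u + tens A B a v"
  and tens_smul_right: "tens A B a (smul B c u) = fscale c (tens A B a u)"
  by (auto simp: tens_def fun_eq_iff fscale_def bilinear_form_def Vector_Spaces.linear_def
      module_hom_def module_hom_axioms_def)

lemma tens_sum_left: "tens A B (\<Sum>i\<in>I. x i) b = (\<Sum>i\<in>I. tens A B (x i) b)"
proof (induction I rule: infinite_finite_induct)
  have "tens A B 0 b = 0" using tens_add_left[of A B 0 0 b] by simp
  then show "\<And>I. infinite I \<Longrightarrow> tens A B (\<Sum>i\<in>I. x i) b = (\<Sum>i\<in>I. tens A B (x i) b)"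
    "tens A B (\<Sum>i\<in>{}. x i) b = (\<Sum>i\<in>{}. tens A B (x i) b)" by simp_all
qed (simp add: tens_add_left)

lemma tens_zero_right: "tens A B a 0 = 0"
  using tens_add_right[of A B a 0 0] by simp

lemma tens_sum_right: "tens A B a (\<Sum>i\<in>I. x i) = (\<Sum>i\<in>I. tens A B a (x i))"
  by (induction I rule: infinite_finite_induct) (simp_all add: tens_add_right tens_zero_right)

lemma tens_in_tensor_space:
  "a \<in> carrier A \<Longrightarrow> b \<in> carrier B \<Longrightarrow> tens A B a b \<in> tensor_space A B"
  unfolding tensor_space_def
  by (rule module.span_base) (use vector_space_fscale in \<open>auto simp: module_iff_vector_space\<close>)

lemma carrier_tensor_algebra: "carrier (tensor_algebra A B) = tensor_space A B"
  and smul_tensor_algebra: "smul (tensor_algebra A B) = fscale"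
  by (simp_all add: tensor_algebra_def)

lemma carrier_space_tensor: "carrier_space (tensor_algebra A B)"
proof -
  interpret vector_space "fscale :: 'k::field \<Rightarrow> ('x \<Rightarrow> 'k) \<Rightarrow> 'x \<Rightarrow> 'k"
    by (rule vector_space_fscale)
  show ?thesis
    using vector_space_fscale subspace_span
    by (simp add: carrier_space_def tensor_algebra_def tensor_space_def)
qed

lemma tensor_space_rep:
  assumes A: "carrier_space A" and t: "t \<in> tensor_space A B"
  obtains m :: nat and a b where "\<And>i. i < m \<Longrightarrow> a i \<in> carrier A"
    "\<And>i. i < m \<Longrightarrow> b i \<in> carrier B" "t = (\<Sum>i<m. tens A B (a i) (b i))"
proof -
  interpret vector_space "fscale :: 'k::field \<Rightarrow> ('x \<Rightarrow> 'k) \<Rightarrow> 'x \<Rightarrow> 'k"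
    by (rule vector_space_fscale)
  have "\<exists>(m::nat) a b. (\<forall>i<m. a i \<in> carrier A \<and> b i \<in> carrier B) \<and> t = (\<Sum>i<m. tens A B (a i) (b i))"
    using t unfolding tensor_space_def
  proof (induction rule: span_induct_alt)
    case base
    show ?case by (rule exI[of _ 0]) simp
  next
    case (step c x y)
    then obtain a0 b0 m a b where x: "x = tens A B a0 b0" "a0 \<in> carrier A" "b0 \<in> carrier B"
      and y: "\<forall>i<(m::nat). a i \<in> carrier A \<and> b i \<in> carrier B" "y = (\<Sum>i<m. tens A B (a i) (b i))"
      by blast
    have "fscale c x + y = (\<Sum>i<m. tens A B (a i) (b i)) + tens A B (smul A c a0) b0"
      using x y by (simp only: tens_smul_left add.commute)
    also have "\<dots> = (\<Sum>i<Suc m. tens A B ((a(m := smul A c a0)) i) ((b(m := b0)) i))"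
      unfolding sum.lessThan_Suc by (intro arg_cong2[where f = "(+)"] sum.cong) auto
    finally have eq: "fscale c x + y =
      (\<Sum>i<Suc m. tens A B ((a(m := smul A c a0)) i) ((b(m := b0)) i))" .
    show ?case
      by (rule exI[of _ "Suc m"], rule exI[of _ "a(m := smul A c a0)"], rule exI[of _ "b(m := b0)"])
        (use x y eq in \<open>simp del: sum.lessThan_Suc add: less_Suc_eq carrier_space_smul[OF A]\<close>)
  qed
  then show ?thesis using that by blast
qed

lemma sweedler_cong:
  assumes "\<And>a b. a \<in> carrier A \<Longrightarrow> b \<in> carrier B \<Longrightarrow> \<phi> a b = \<psi> a b"
  shows "sweedler A B \<phi> t = sweedler A B \<psi> t"
proof -
  have "(\<Sum>i<m. \<phi> (a i) (b i)) = (\<Sum>i<m. \<psi> (a i) (b i))"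
    if "\<forall>i<(m::nat). a i \<in> carrier A \<and> b i \<in> carrier B" for m a b
    using that assms by (intro sum.cong) auto
  then show ?thesis unfolding sweedler_def by (intro arg_cong[of _ _ The] ext ex_cong1 conj_cong refl) auto
qed

context
  fixes A :: "('k::field, 'a::ab_group_add, 'm) algebra_scheme"
    and B :: "('k, 'b::ab_group_add, 'n) algebra_scheme"
  assumes A: "carrier_space A" and B: "carrier_space B"
begin

lemma sweedler_rep:
  assumes "vector_space s" "bilinear_on_carriers A B s \<phi>"
    and "\<And>i. i < m \<Longrightarrow> a i \<in> carrier A" "\<And>i. i < m \<Longrightarrow> b i \<in> carrier B"
  shows "sweedler A B \<phi> (\<Sum>i<m. tens A B (a i) (b i)) = (\<Sum>i<(m::nat). \<phi> (a i) (b i))"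
  using sweedler_sum[of A B s \<phi> m a b] A B assms by (simp add: carrier_space_def)

lemma sweedler_tens:
  assumes "vector_space s" "bilinear_on_carriers A B s \<phi>" "a \<in> carrier A" "b \<in> carrier B"
  shows "sweedler A B \<phi> (tens A B a b) = \<phi> a b"
  using sweedler_rep[OF assms(1,2), of 1 "\<lambda>_. a" "\<lambda>_. b"] assms by simp

lemma linear_sweedler:
  assumes s: "vector_space s" and \<phi>: "bilinear_on_carriers A B s \<phi>"
  shows "linear_on_carrier (tensor_algebra A B) s (sweedler A B \<phi>)"
proof (rule linear_on_carrierI)
  interpret vector_space s by fact
  interpret F: vector_space "fscale :: 'k \<Rightarrow> ('x \<Rightarrow> 'k) \<Rightarrow> 'x \<Rightarrow> 'k"
    by (rule vector_space_fscale)
  fix t assume "t \<in> carrier (tensor_algebra A B)"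
  then obtain m :: nat and a b where ab: "\<And>i. i < m \<Longrightarrow> a i \<in> carrier A"
    "\<And>i. i < m \<Longrightarrow> b i \<in> carrier B" and t: "t = (\<Sum>i<m. tens A B (a i) (b i))"
    using tensor_space_rep[OF A] by (metis carrier_tensor_algebra)
  have "fscale c t = (\<Sum>i<m. tens A B (smul A c (a i)) (b i))" for c
    unfolding t tens_smul_left by (rule F.scale_sum_right)
  then have "sweedler A B \<phi> (fscale c t) = (\<Sum>i<m. \<phi> (smul A c (a i)) (b i))" for c
    using sweedler_rep[OF s \<phi>] ab carrier_space_smul[OF A] by simp
  moreover have "sweedler A B \<phi> t = (\<Sum>i<m. \<phi> (a i) (b i))"
    using sweedler_rep[OF s \<phi>] ab t by simp
  ultimately show "sweedler A B \<phi> (smul (tensor_algebra A B) c t) = s c (sweedler A B \<phi> t)" for c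
    using ab \<phi> by (simp add: smul_tensor_algebra scale_sum_right bilinear_on_carriers_def
        linear_on_carrier_def)
  fix u assume "u \<in> carrier (tensor_algebra A B)"
  then obtain k :: nat and c d where cd: "\<And>i. i < k \<Longrightarrow> c i \<in> carrier A"
    "\<And>i. i < k \<Longrightarrow> d i \<in> carrier B" and u: "u = (\<Sum>i<k. tens A B (c i) (d i))"
    using tensor_space_rep[OF A] by (metis carrier_tensor_algebra)
  \<comment> \<open>The concatenation of the representations of \<open>t\<close> and \<open>u\<close> represents \<open>t + u\<close>.\<close>
  define a' where "a' = (\<lambda>i. if i < m then a i else c (i - m))"
  define b' where "b' = (\<lambda>i. if i < m then b i else d (i - m))"
  have split: "(\<Sum>i<m+k. F (a' i) (b' i)) = (\<Sum>i<m. F (a i) (b i)) + (\<Sum>i<k. F (c i) (d i))"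
    for F :: "'a \<Rightarrow> 'b \<Rightarrow> 'y::ab_group_add"
    unfolding a'_def b'_def by (induction k) (simp_all add: add.assoc)
  have "t + u = (\<Sum>i<m+k. tens A B (a' i) (b' i))" using split[of "tens A B"] t u by simp
  then have "sweedler A B \<phi> (t + u) = (\<Sum>i<m+k. \<phi> (a' i) (b' i))"
    using sweedler_rep[OF s \<phi>, of "m+k" a' b'] ab cd by (simp add: a'_def b'_def)
  also have "\<dots> = sweedler A B \<phi> t + sweedler A B \<phi> u"
    using split[of \<phi>] sweedler_rep[OF s \<phi>] ab cd t u by simp
  finally show "sweedler A B \<phi> (t + u) = sweedler A B \<phi> t + sweedler A B \<phi> u" .
qed

lemma sweedler_closed:
  assumes W: "carrier_space W" and \<phi>: "bilinear_on_carriers A B (smul W) \<phi>"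
    and \<phi>W: "\<And>a b. a \<in> carrier A \<Longrightarrow> b \<in> carrier B \<Longrightarrow> \<phi> a b \<in> carrier W"
    and t: "t \<in> tensor_space A B"
  shows "sweedler A B \<phi> t \<in> carrier W"
  using t
proof (rule tensor_space_rep[OF A])
  fix m :: nat and a b
  assume "\<And>i. i < m \<Longrightarrow> a i \<in> carrier A" "\<And>i. i < m \<Longrightarrow> b i \<in> carrier B"
    "t = (\<Sum>i<m. tens A B (a i) (b i))"
  then show ?thesis
    using sweedler_rep[OF carrier_space_vector_space[OF W] \<phi>] \<phi>W
    by (auto intro: carrier_space_sum[OF W])
qed

text \<open>
  The map on the tensor product induced by a bilinear map is natural in its target. Identities
  between nested Sweedler sums are reduced to pure tensors by pushing linear maps inside with
  this rule.
\<close>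

lemma linear_sweedler_push:
  assumes W: "carrier_space W" and \<phi>: "bilinear_on_carriers A B (smul W) \<phi>"
    and \<phi>W: "\<And>a b. a \<in> carrier A \<Longrightarrow> b \<in> carrier B \<Longrightarrow> \<phi> a b \<in> carrier W"
    and s: "vector_space s" and L: "linear_on_carrier W s L" and t: "t \<in> tensor_space A B"
  shows "L (sweedler A B \<phi> t) = sweedler A B (\<lambda>a b. L (\<phi> a b)) t"
  using t
proof (rule tensor_space_rep[OF A])
  fix m :: nat and a b
  assume ab: "\<And>i. i < m \<Longrightarrow> a i \<in> carrier A" "\<And>i. i < m \<Longrightarrow> b i \<in> carrier B"
    "t = (\<Sum>i<m. tens A B (a i) (b i))"
  have L\<phi>: "bilinear_on_carriers A B s (\<lambda>a b. L (\<phi> a b))"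
    using \<phi> \<phi>W L by (simp add: bilinear_on_carriers_def linear_on_carrier_def)
  have "L (sweedler A B \<phi> t) = L (\<Sum>i<m. \<phi> (a i) (b i))"
    using sweedler_rep[OF carrier_space_vector_space[OF W] \<phi>] ab by simp
  also have "\<dots> = (\<Sum>i<m. L (\<phi> (a i) (b i)))"
    by (rule linear_on_carrier_sum[OF W L]) (use ab \<phi>W in auto)
  also have "\<dots> = sweedler A B (\<lambda>a b. L (\<phi> a b)) t"
    using sweedler_rep[OF s L\<phi>] ab by simp
  finally show ?thesis .
qed

lemma linear_sweedler_param:
  assumes s: "vector_space s"
    and \<phi>: "\<And>x. x \<in> carrier P \<Longrightarrow> bilinear_on_carriers A B s (\<phi> x)" and P: "carrier_space P"
    and lin: "\<And>a b. a \<in> carrier A \<Longrightarrow> b \<in> carrier B \<Longrightarrow> linear_on_carrier P s (\<lambda>x. \<phi> x a b)"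
    and t: "t \<in> tensor_space A B"
  shows "linear_on_carrier P s (\<lambda>x. sweedler A B (\<phi> x) t)"
  using t
proof (rule tensor_space_rep[OF A])
  fix m :: nat and a b
  assume ab: "\<And>i. i < m \<Longrightarrow> a i \<in> carrier A" "\<And>i. i < m \<Longrightarrow> b i \<in> carrier B"
    "t = (\<Sum>i<m. tens A B (a i) (b i))"
  have eq: "sweedler A B (\<phi> x) t = (\<Sum>i<m. \<phi> x (a i) (b i))" if "x \<in> carrier P" for x
    using sweedler_rep[OF s \<phi>] that ab by simp
  have "linear_on_carrier P s (\<lambda>x. \<Sum>i<m. \<phi> x (a i) (b i))"
    using ab lin by (intro linear_on_carrier_sumI s) auto
  then show ?thesis
    using eq P by (simp add: linear_on_carrier_def carrier_space_add carrier_space_smul)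
qed

end

lemma sweedler_swap:
  assumes "carrier_space A" "carrier_space B" "carrier_space A'" "carrier_space B'" "vector_space s"
    and 1: "\<And>c d. c \<in> carrier A' \<Longrightarrow> d \<in> carrier B' \<Longrightarrow> bilinear_on_carriers A B s (\<lambda>a b. \<phi> a b c d)"
    and 2: "\<And>a b. a \<in> carrier A \<Longrightarrow> b \<in> carrier B \<Longrightarrow> bilinear_on_carriers A' B' s (\<phi> a b)"
    and t: "t \<in> tensor_space A B" and u: "u \<in> tensor_space A' B'"
  shows "sweedler A B (\<lambda>a b. sweedler A' B' (\<phi> a b) u) t =
    sweedler A' B' (\<lambda>c d. sweedler A B (\<lambda>a b. \<phi> a b c d) t) u"
proof -
  obtain m :: nat and a b where ab: "\<And>i. i < m \<Longrightarrow> a i \<in> carrier A"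
    "\<And>i. i < m \<Longrightarrow> b i \<in> carrier B" "t = (\<Sum>i<m. tens A B (a i) (b i))"
    using tensor_space_rep[OF assms(1) t] by metis
  obtain k :: nat and c d where cd: "\<And>i. i < k \<Longrightarrow> c i \<in> carrier A'"
    "\<And>i. i < k \<Longrightarrow> d i \<in> carrier B'" "u = (\<Sum>i<k. tens A' B' (c i) (d i))"
    using tensor_space_rep[OF assms(3) u] by metis
  have 3: "bilinear_on_carriers A B s (\<lambda>a b. sweedler A' B' (\<phi> a b) u)"
    using 1 2 by (intro bilinear_on_carriersI linear_sweedler_param assms)
      (auto simp: bilinear_on_carriers_def)
  have 4: "bilinear_on_carriers A' B' s (\<lambda>c d. sweedler A B (\<lambda>a b. \<phi> a b c d) t)"
    using 1 2 by (intro bilinear_on_carriersI linear_sweedler_param assms)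
      (auto simp: bilinear_on_carriers_def)
  have "sweedler A B (\<lambda>a b. sweedler A' B' (\<phi> a b) u) t = (\<Sum>i<m. \<Sum>j<k. \<phi> (a i) (b i) (c j) (d j))"
    using sweedler_rep[OF assms(1,2,5) 3] sweedler_rep[OF assms(3,4,5) 2] ab cd by simp
  moreover have "sweedler A' B' (\<lambda>c d. sweedler A B (\<lambda>a b. \<phi> a b c d) t) u
      = (\<Sum>j<k. \<Sum>i<m. \<phi> (a i) (b i) (c j) (d j))"
    using sweedler_rep[OF assms(3,4,5) 4] sweedler_rep[OF assms(1,2,5) 1] ab cd by simp
  ultimately show ?thesis by (simp add: sum.swap[of _ "{..<m}"])
qed

text \<open>
  Linearly independent left factors make the right factors unique, by the lemma after this one.
  So a tensor vanishes as soon as each of these right factors does, and this can be tested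
  separately for each of them.
\<close>

lemma tensor_space_rep_independent:
  assumes A: "carrier_space A" and B: "carrier_space B" and t: "t \<in> tensor_space A B"
  obtains E g where "finite E" "E \<subseteq> carrier A" "\<not> module.dependent (smul A) E"
    "\<And>e. e \<in> E \<Longrightarrow> g e \<in> carrier B" "t = (\<Sum>e\<in>E. tens A B e (g e))"
proof -
  interpret V: vector_space "smul A" using A by (simp add: carrier_space_def)
  obtain m :: nat and a b where a: "\<And>i. i < m \<Longrightarrow> a i \<in> carrier A"
    and b: "\<And>i. i < m \<Longrightarrow> b i \<in> carrier B" and eq: "t = (\<Sum>i<m. tens A B (a i) (b i))"
    using tensor_space_rep[OF A t] by metis
  obtain E where E: "E \<subseteq> a ` {..<m}" "V.independent E" "a ` {..<m} \<subseteq> V.span E"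
    using V.maximal_independent_subset by blast
  have fin: "finite E" using E(1) finite_subset by blast
  define g where "g = (\<lambda>e. \<Sum>i<m. smul B (V.representation E (a i) e) (b i))"
  have ai: "a i = (\<Sum>e\<in>E. smul A (V.representation E (a i) e) e)" if "i < m" for i
    using V.sum_representation_eq[OF E(2) _ fin order.refl, of "a i"] E(3) that by auto
  have "tens A B (a i) (b i) = (\<Sum>e\<in>E. tens A B e (smul B (V.representation E (a i) e) (b i)))"
    if "i < m" for i
    using arg_cong[OF ai[OF that], of "\<lambda>x. tens A B x (b i)"]
    unfolding tens_sum_left tens_smul_left tens_smul_right .
  then have "t = (\<Sum>i<m. \<Sum>e\<in>E. tens A B e (smul B (V.representation E (a i) e) (b i)))"
    using eq by simp
  also have "\<dots> = (\<Sum>e\<in>E. tens A B e (g e))"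
    unfolding g_def tens_sum_right by (rule sum.swap)
  finally show ?thesis
    using that[OF fin _ E(2), of g] E(1) a b
    by (force simp: g_def intro: carrier_space_sum[OF B] carrier_space_smul[OF B])
qed

lemma sum_tens_independent_eq_0:
  fixes A :: "('k::field, 'a::ab_group_add, 'm) algebra_scheme"
    and B :: "('k, 'b::ab_group_add, 'n) algebra_scheme"
  assumes A: "carrier_space A" and B: "carrier_space B"
    and fin: "finite E" and ind: "\<not> module.dependent (smul A) E"
    and 0: "(\<Sum>e\<in>E. tens A B e (g e)) = 0" and e: "e \<in> E"
  shows "g e = 0"
proof (rule ccontr)
  assume "g e \<noteq> 0"
  then obtain \<psi> where \<psi>: "Vector_Spaces.linear (smul B) (*) \<psi>" "\<psi> (g e) \<noteq> (0::'k)"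
    using separating_functional[OF carrier_space_vector_space[OF B]] by metis
  have P: "vector_space_pair (smul A) ((*) :: 'k \<Rightarrow> 'k \<Rightarrow> 'k)"
    using carrier_space_vector_space[OF A]
    by (simp add: vector_space_pair_def) (unfold_locales, auto simp: algebra_simps)
  obtain \<chi> where \<chi>: "Vector_Spaces.linear (smul A) (*) \<chi>"
    and \<chi>E: "\<forall>x\<in>E. \<chi> x = (if x = e then 1 else 0 :: 'k)"
    using vector_space_pair.linear_independent_extend[OF P ind, of "\<lambda>x. if x = e then 1 else 0"] by blast
  have bf: "bilinear_form (smul A) (smul B) (\<lambda>x y. \<chi> x * \<psi> y)"
    using \<chi> \<psi>(1) unfolding bilinear_form_def Vector_Spaces.linear_def module_hom_iff
    by (simp add: distrib_left distrib_right mult.assoc mult.left_commute)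
  have "0 = (\<Sum>e\<in>E. tens A B e (g e)) (\<lambda>x y. \<chi> x * \<psi> y)" unfolding 0 by simp
  also have "\<dots> = (\<Sum>x\<in>E. \<chi> x * \<psi> (g x))"
    using fin by (induction E rule: finite_induct) (simp_all add: tens_def bf)
  also have "\<dots> = (\<Sum>x\<in>E. if x = e then \<psi> (g x) else 0)"
    using \<chi>E by (intro sum.cong) auto
  finally show False using \<psi>(2) e fin by simp
qed


section \<open>Closure rules for multilinear expressions\<close>

lemma vector_space_mult: "vector_space ((*) :: 'k::field \<Rightarrow> 'k \<Rightarrow> 'k)"
  by unfold_locales (auto simp: algebra_simps)

lemma linear_ident: "linear_on_carrier A (smul A) (\<lambda>x. x)"
  by (simp add: linear_on_carrier_def)

lemma linear_ident_tensor: "linear_on_carrier (tensor_algebra A B) fscale (\<lambda>x. x)"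
  by (simp add: linear_on_carrier_def smul_tensor_algebra)

lemma linear_on_carrier_compose:
  assumes "linear_on_carrier P (smul W) f" "\<And>x. x \<in> carrier P \<Longrightarrow> f x \<in> carrier W"
    and "linear_on_carrier W s g"
  shows "linear_on_carrier P s (\<lambda>x. g (f x))"
  using assms by (simp add: linear_on_carrier_def)

lemma bilinear_compose_left:
  assumes "bilinear_on_carriers A B s \<phi>" "linear_on_carrier P (smul A) f"
    "\<And>x. x \<in> carrier P \<Longrightarrow> f x \<in> carrier A" "b \<in> carrier B"
  shows "linear_on_carrier P s (\<lambda>x. \<phi> (f x) b)"
  using assms by (simp add: linear_on_carrier_def bilinear_on_carriers_def)

lemma bilinear_compose_right:
  assumes "bilinear_on_carriers A B s \<phi>" "linear_on_carrier P (smul B) f"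
    "\<And>x. x \<in> carrier P \<Longrightarrow> f x \<in> carrier B" "a \<in> carrier A"
  shows "linear_on_carrier P s (\<lambda>x. \<phi> a (f x))"
  using assms by (simp add: linear_on_carrier_def bilinear_on_carriers_def)

lemma linear_tens_left:
  "linear_on_carrier P (smul A) f \<Longrightarrow> linear_on_carrier P fscale (\<lambda>x. tens A B (f x) b)"
  and linear_tens_right:
  "linear_on_carrier P (smul B) g \<Longrightarrow> linear_on_carrier P fscale (\<lambda>x. tens A B a (g x))"
  by (simp_all add: linear_on_carrier_def tens_add_left tens_smul_left tens_add_right tens_smul_right)

lemma linear_tens_tensor_right:
  "linear_on_carrier P fscale g \<Longrightarrow>
    linear_on_carrier P fscale (\<lambda>x. tens A (tensor_algebra B C) a (g x))"
  by (rule linear_tens_right) (simp add: smul_tensor_algebra)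

lemma linear_smul:
  "vector_space s \<Longrightarrow> linear_on_carrier P s f \<Longrightarrow> linear_on_carrier P s (\<lambda>x. s c (f x))"
  by (simp add: linear_on_carrier_def vector_space_def mult.commute)

lemma linear_smul_coefficient:
  "vector_space s \<Longrightarrow> linear_on_carrier P (*) f \<Longrightarrow> linear_on_carrier P s (\<lambda>x. s (f x) c)"
  by (simp add: linear_on_carrier_def vector_space_def)

lemma linear_sweedler_arg:
  assumes "carrier_space A" "carrier_space B" "vector_space s" "bilinear_on_carriers A B s \<phi>"
    "linear_on_carrier P fscale f" "\<And>x. x \<in> carrier P \<Longrightarrow> f x \<in> tensor_space A B"
  shows "linear_on_carrier P s (\<lambda>x. sweedler A B \<phi> (f x))"
  by (rule linear_on_carrier_compose[of P "tensor_algebra A B" f])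
    (use assms linear_sweedler in \<open>auto simp: carrier_tensor_algebra smul_tensor_algebra\<close>)

lemma tens_in_tensor_space2:
  "a \<in> carrier A \<Longrightarrow> b \<in> tensor_space B C \<Longrightarrow>
    tens A (tensor_algebra B C) a b \<in> tensor_space A (tensor_algebra B C)"
  by (simp add: tens_in_tensor_space carrier_tensor_algebra)

lemma sweedler_closed_tensor:
  assumes "carrier_space A" "carrier_space B" "bilinear_on_carriers A B fscale \<phi>"
    "\<And>a b. a \<in> carrier A \<Longrightarrow> b \<in> carrier B \<Longrightarrow> \<phi> a b \<in> tensor_space X Y" "t \<in> tensor_space A B"
  shows "sweedler A B \<phi> t \<in> tensor_space X Y"
  using sweedler_closed[of A B "tensor_algebra X Y" \<phi> t] assms
  by (simp add: carrier_tensor_algebra smul_tensor_algebra carrier_space_tensor)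

lemma linear_sweedler_push_tensor:
  assumes "carrier_space A" "carrier_space B" "bilinear_on_carriers A B fscale \<phi>"
    "\<And>a b. a \<in> carrier A \<Longrightarrow> b \<in> carrier B \<Longrightarrow> \<phi> a b \<in> tensor_space X Y"
    "vector_space s" "linear_on_carrier (tensor_algebra X Y) s L" "t \<in> tensor_space A B"
  shows "L (sweedler A B \<phi> t) = sweedler A B (\<lambda>a b. L (\<phi> a b)) t"
  using linear_sweedler_push[of A B "tensor_algebra X Y" \<phi> s L t] assms
  by (simp add: carrier_tensor_algebra smul_tensor_algebra carrier_space_tensor)

lemma smul_sweedler:
  fixes \<phi> :: "'a::ab_group_add \<Rightarrow> 'b::ab_group_add \<Rightarrow> 'k::field"
  assumes A: "carrier_space A" and B: "carrier_space B" and s: "vector_space s"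
    and \<phi>: "bilinear_on_carriers A B (*) \<phi>" and t: "t \<in> tensor_space A B"
  shows "s (sweedler A B \<phi> t) c = sweedler A B (\<lambda>a b. s (\<phi> a b) c) t"
proof -
  \<comment> \<open>The ground field, as target of \<open>\<phi>\<close>.\<close>
  define K where "K = (\<lparr>carrier = UNIV, smul = (*), mult = (*), unity = 1\<rparr> :: ('k, 'k) algebra)"
  have K: "carrier_space K"
    using module.subspace_UNIV[of "(*) :: 'k \<Rightarrow> 'k \<Rightarrow> 'k"]
    by (simp add: carrier_space_def K_def module_iff_vector_space vector_space_mult)
  have L: "linear_on_carrier K s (\<lambda>x. s x c)"
    using s by (simp add: linear_on_carrier_def K_def vector_space_def)
  show ?thesis
    by (rule linear_sweedler_push[OF A B K _ _ s L t]) (use \<phi> in \<open>simp_all add: K_def\<close>)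
qed

lemma is_algebra_carrier_space: "is_algebra A \<Longrightarrow> carrier_space A"
  by (simp add: is_algebra_def carrier_space_def)

lemma tensor_carrierD: "x \<in> carrier (tensor_algebra A B) \<Longrightarrow> x \<in> tensor_space A B"
  by (simp add: carrier_tensor_algebra)

text \<open>
  Multilinearity of an expression follows from its syntax: applied backwards, these rules descend
  from the outermost operation to the variable. The rules for the operations of a
  particular algebra are added where that algebra is fixed.
\<close>

lemmas multilinear_intros =
  vector_space_mult vector_space_fscale carrier_space_tensor
  bilinear_on_carriersI linear_ident linear_ident_tensor
  linear_tens_tensor_right linear_tens_left linear_tens_right
  linear_smul linear_smul_coefficient
  linear_sweedler_param linear_sweedler_arg
  tens_in_tensor_space2 tens_in_tensor_space sweedler_closed sweedler_closed_tensor


section \<open>Faithful Hopf actions\<close>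

locale hopf_action =
  fixes H :: "('k::field, 'h::ab_group_add, 'n) hopf_scheme"
    and A :: "('k, 'a::ab_group_add, 'm) algebra_scheme"
    and act :: "'a \<Rightarrow> 'h \<Rightarrow> 'a"
  assumes bialgebra: "is_bialgebra H" and algebra: "is_algebra A"
    and hopf_action: "is_right_hopf_action A H act"
begin

lemma H_algebra: "is_algebra H" using bialgebra by (simp add: is_bialgebra_def)

lemmas H_space = is_algebra_carrier_space[OF H_algebra]
lemmas A_space = is_algebra_carrier_space[OF algebra]

lemma mult_closed: "a \<in> carrier A \<Longrightarrow> b \<in> carrier A \<Longrightarrow> mult A a b \<in> carrier A"
  and unity_closed: "unity A \<in> carrier A"
  and mult_assoc: "a \<in> carrier A \<Longrightarrow> b \<in> carrier A \<Longrightarrow> c \<in> carrier A \<Longrightarrow>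
    mult A (mult A a b) c = mult A a (mult A b c)"
  and mult_unity: "a \<in> carrier A \<Longrightarrow> mult A (unity A) a = a" "a \<in> carrier A \<Longrightarrow> mult A a (unity A) = a"
  and mult_bilinear: "bilinear_on_carriers A A (smul A) (mult A)"
  using algebra by (simp_all add: is_algebra_def)

lemma H_mult_closed: "h \<in> carrier H \<Longrightarrow> h' \<in> carrier H \<Longrightarrow> mult H h h' \<in> carrier H"
  and H_unity_closed: "unity H \<in> carrier H"
  and H_mult_bilinear: "bilinear_on_carriers H H (smul H) (mult H)"
  using H_algebra by (simp_all add: is_algebra_def)

lemma comult_closed: "h \<in> carrier H \<Longrightarrow> comult H h \<in> tensor_space H H"
  and comult_linear: "linear_on_carrier H fscale (comult H)"
  and counit_linear: "linear_on_carrier H (*) (counit H)"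
  using bialgebra by (simp_all add: is_bialgebra_def)

lemma act_closed: "a \<in> carrier A \<Longrightarrow> h \<in> carrier H \<Longrightarrow> act a h \<in> carrier A"
  and act_bilinear: "bilinear_on_carriers A H (smul A) act"
  and act_unity: "a \<in> carrier A \<Longrightarrow> act a (unity H) = a"
  and act_mult: "a \<in> carrier A \<Longrightarrow> h \<in> carrier H \<Longrightarrow> h' \<in> carrier H \<Longrightarrow>
    act a (mult H h h') = act (act a h) h'"
  and mult_act: "a \<in> carrier A \<Longrightarrow> b \<in> carrier A \<Longrightarrow> h \<in> carrier H \<Longrightarrow>
    act (mult A a b) h = sweedler H H (\<lambda>h1 h2. mult A (act a h1) (act b h2)) (comult H h)"
  and unity_act: "h \<in> carrier H \<Longrightarrow> act (unity A) h = smul A (counit H h) (unity A)"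
  using hopf_action by (simp_all add: is_right_hopf_action_def is_right_action_def)

lemmas action_intros = multilinear_intros H_space A_space
  carrier_space_vector_space[OF H_space] carrier_space_vector_space[OF A_space]
  mult_closed unity_closed H_mult_closed H_unity_closed comult_closed act_closed
  bilinear_compose_left[OF mult_bilinear] bilinear_compose_right[OF mult_bilinear]
  bilinear_compose_left[OF H_mult_bilinear] bilinear_compose_right[OF H_mult_bilinear]
  bilinear_compose_left[OF act_bilinear] bilinear_compose_right[OF act_bilinear]
  linear_on_carrier_compose[OF _ _ counit_linear]
  carrier_space_smul[OF A_space]

lemma linear_comult_compose:
  "linear_on_carrier P (smul H) f \<Longrightarrow> (\<And>x. x \<in> carrier P \<Longrightarrow> f x \<in> carrier H) \<Longrightarrow>
    linear_on_carrier P fscale (\<lambda>x. comult H (f x))"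
  by (rule linear_on_carrier_compose[OF _ _ comult_linear])

text \<open>
  The linear extension to tensors of \<open>h \<otimes> a \<mapsto> (D \<mapsto> (D \<triangleleft> h) a)\<close>. The smash product is designed to
  compose these operators, in the opposite order.
\<close>

definition operator :: "('k, 'h, 'a) tensor \<Rightarrow> 'a \<Rightarrow> 'a"
  where "operator t D = sweedler H A (\<lambda>h a. mult A (act D h) a) t"

lemma operator_closed:
  "t \<in> tensor_space H A \<Longrightarrow> D \<in> carrier A \<Longrightarrow> operator t D \<in> carrier A"
  unfolding operator_def by (intro action_intros linear_comult_compose | assumption)+

lemma operator_linear: "D \<in> carrier A \<Longrightarrow> linear_on_carrier (tensor_algebra H A) (smul A) (\<lambda>t. operator t D)"
  unfolding operator_def
  by (intro action_intros linear_comult_compose | assumption | erule tensor_carrierD)+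

lemma operator_add:
  "s \<in> tensor_space H A \<Longrightarrow> t \<in> tensor_space H A \<Longrightarrow> D \<in> carrier A \<Longrightarrow>
    operator (s + t) D = operator s D + operator t D"
  and operator_smul:
  "s \<in> tensor_space H A \<Longrightarrow> D \<in> carrier A \<Longrightarrow> operator (fscale c s) D = smul A c (operator s D)"
  using linear_on_carrier_add[OF operator_linear] linear_on_carrier_smul[OF operator_linear]
  by (simp_all add: carrier_tensor_algebra smul_tensor_algebra)

lemma tensor_space_add:
  "s \<in> tensor_space H A \<Longrightarrow> t \<in> tensor_space H A \<Longrightarrow> s + t \<in> tensor_space H A"
  and tensor_space_fscale: "s \<in> tensor_space H A \<Longrightarrow> fscale c s \<in> tensor_space H A"
  using carrier_space_add[OF carrier_space_tensor] carrier_space_smul[OF carrier_space_tensor]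
  by (simp_all add: carrier_tensor_algebra smul_tensor_algebra)

lemma operator_linear_right:
  "t \<in> tensor_space H A \<Longrightarrow> linear_on_carrier A (smul A) (operator t)"
  unfolding operator_def by (intro action_intros linear_comult_compose | assumption)+

lemma operator_compose:
  "t \<in> tensor_space H A \<Longrightarrow> linear_on_carrier P (smul A) f \<Longrightarrow>
    (\<And>x. x \<in> carrier P \<Longrightarrow> f x \<in> carrier A) \<Longrightarrow> linear_on_carrier P (smul A) (\<lambda>x. operator t (f x))"
  by (rule linear_on_carrier_compose[OF _ _ operator_linear_right])

lemma operator_tensor_compose:
  "D \<in> carrier A \<Longrightarrow> linear_on_carrier P fscale f \<Longrightarrow>
    (\<And>x. x \<in> carrier P \<Longrightarrow> f x \<in> tensor_space H A) \<Longrightarrow>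
    linear_on_carrier P (smul A) (\<lambda>x. operator (f x) D)"
  by (rule linear_on_carrier_compose[OF _ _ operator_linear])
    (simp_all add: smul_tensor_algebra carrier_tensor_algebra)

lemmas operator_intros = action_intros linear_comult_compose operator_closed operator_compose
  operator_tensor_compose operator_linear operator_linear_right

lemma operator_tens:
  assumes "h \<in> carrier H" "a \<in> carrier A" "D \<in> carrier A"
  shows "operator (tens H A h a) D = mult A (act D h) a"
  unfolding operator_def
  by (rule sweedler_tens[of H A "smul A"]) (intro operator_intros assms | assumption)+

lemma operator_sweedler:
  assumes "carrier_space P" "carrier_space Q" "bilinear_on_carriers P Q fscale \<phi>"
    "\<And>a b. a \<in> carrier P \<Longrightarrow> b \<in> carrier Q \<Longrightarrow> \<phi> a b \<in> tensor_space H A"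
    "t \<in> tensor_space P Q" "D \<in> carrier A"
  shows "operator (sweedler P Q \<phi> t) D = sweedler P Q (\<lambda>a b. operator (\<phi> a b) D) t"
  by (rule linear_sweedler_push_tensor[OF assms(1-4) _ operator_linear[OF assms(6)] assms(5)])
    (assumption | rule carrier_space_vector_space[OF A_space])+

lemma smash_product_simps:
  "carrier (smash_product H A act) = tensor_space H A"
  "smul (smash_product H A act) = fscale"
  "unity (smash_product H A act) = tens H A (unity H) (unity A)"
  by (simp_all add: smash_product_def)

lemma smash_mult_closed:
  assumes "s \<in> tensor_space H A" "t \<in> tensor_space H A"
  shows "mult (smash_product H A act) s t \<in> tensor_space H A"
  unfolding smash_product_def algebra.simps
  by (intro assms operator_intros | assumption)+

text \<open>
  The compatibility of the action with products, with a further factor on the right as it occurs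
  in the operators of composite tensors.
\<close>

lemma action_product:
  assumes "D \<in> carrier A" "a \<in> carrier A" "b \<in> carrier A" "h \<in> carrier H"
  shows "sweedler H H (\<lambda>h1 h2. mult A (act D h1) (mult A (act a h2) b)) (comult H h)
    = mult A (act (mult A D a) h) b"
proof -
  have "sweedler H H (\<lambda>h1 h2. mult A (act D h1) (mult A (act a h2) b)) (comult H h)
      = sweedler H H (\<lambda>h1 h2. mult A (mult A (act D h1) (act a h2)) b) (comult H h)"
    by (rule sweedler_cong) (simp add: assms mult_assoc act_closed)
  also have "\<dots> = mult A (sweedler H H (\<lambda>h1 h2. mult A (act D h1) (act a h2)) (comult H h)) b"
    by (rule linear_sweedler_push[where L = "\<lambda>x. mult A x b" and s = "smul A" and W = A, symmetric])
      (intro assms operator_intros | assumption)+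
  also have "\<dots> = mult A (act (mult A D a) h) b"
    using assms by (simp add: mult_act)
  finally show ?thesis .
qed

text \<open>
  On pure tensors, applying \<open>h' \<otimes> a'\<close> after \<open>h \<otimes> a\<close> gives \<open>(((D \<triangleleft> h) a) \<triangleleft> h') a'\<close>, and the Hopf action
  distributes \<open>h'\<close> to \<open>\<Sum> (D \<triangleleft> h h'\<^sub>1) (a \<triangleleft> h'\<^sub>2) a'\<close>. The latter is the operator of the product.
\<close>

lemma operator_smash_mult:
  assumes s: "s \<in> tensor_space H A" and t: "t \<in> tensor_space H A" and D: "D \<in> carrier A"
  shows "operator (mult (smash_product H A act) s t) D = operator t (operator s D)"
proof -
  have 1: "operator (sweedler H H (\<lambda>h1 h2. tens H A (mult H h h1) (mult A (act a h2) a')) (comult H h')) D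
      = mult A (act (mult A (act D h) a) h') a'"
    if m: "h \<in> carrier H" "a \<in> carrier A" "h' \<in> carrier H" "a' \<in> carrier A" for h a h' a'
  proof -
    have "operator (sweedler H H (\<lambda>h1 h2. tens H A (mult H h h1) (mult A (act a h2) a')) (comult H h')) D
       = sweedler H H (\<lambda>h1 h2. operator (tens H A (mult H h h1) (mult A (act a h2) a')) D) (comult H h')"
      by (rule operator_sweedler) (intro m D operator_intros | assumption)+
    also have "\<dots> = sweedler H H (\<lambda>h1 h2. mult A (act (act D h) h1) (mult A (act a h2) a')) (comult H h')"
      by (rule sweedler_cong)
        (simp add: m D operator_tens act_mult act_closed mult_closed H_mult_closed)
    also have "\<dots> = mult A (act (mult A (act D h) a) h') a'"
      by (rule action_product) (intro m D operator_intros)+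
    finally show ?thesis .
  qed
  have 2: "operator (sweedler H A (\<lambda>h' a'. sweedler H H
        (\<lambda>h1 h2. tens H A (mult H h h1) (mult A (act a h2) a')) (comult H h')) t) D
      = operator t (mult A (act D h) a)"
    if m: "h \<in> carrier H" "a \<in> carrier A" for h a
  proof -
    have "operator (sweedler H A (\<lambda>h' a'. sweedler H H
        (\<lambda>h1 h2. tens H A (mult H h h1) (mult A (act a h2) a')) (comult H h')) t) D
      = sweedler H A (\<lambda>h' a'. operator (sweedler H H
        (\<lambda>h1 h2. tens H A (mult H h h1) (mult A (act a h2) a')) (comult H h')) D) t"
      by (rule operator_sweedler) (intro m s t D operator_intros | assumption)+
    also have "\<dots> = operator t (mult A (act D h) a)"
      unfolding operator_def[of t] by (rule sweedler_cong) (simp add: 1 m)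
    finally show ?thesis .
  qed
  have "operator (mult (smash_product H A act) s t) D
     = sweedler H A (\<lambda>h a. operator (sweedler H A (\<lambda>h' a'. sweedler H H
        (\<lambda>h1 h2. tens H A (mult H h h1) (mult A (act a h2) a')) (comult H h')) t) D) s"
    unfolding smash_product_def algebra.simps
    by (rule operator_sweedler) (intro s t D operator_intros | assumption)+
  also have "\<dots> = sweedler H A (\<lambda>h a. operator t (mult A (act D h) a)) s"
    by (rule sweedler_cong) (simp add: 2)
  also have "\<dots> = operator t (operator s D)"
    unfolding operator_def[of s]
    by (rule linear_sweedler_push[where L = "operator t" and s = "smul A" and W = A, symmetric])
      (intro s t D operator_intros | assumption)+
  finally show ?thesis .
qed

end

locale faithful_hopf_action = hopf_action +
  assumes faithful: "t \<in> tensor_space H A \<Longrightarrow> (\<And>D. D \<in> carrier A \<Longrightarrow> operator t D = 0) \<Longrightarrow> t = 0"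
begin

lemma operator_inject:
  assumes s: "s \<in> tensor_space H A" and t: "t \<in> tensor_space H A"
    and eq: "\<And>D. D \<in> carrier A \<Longrightarrow> operator s D = operator t D"
  shows "s = t"
proof -
  have "s - t \<in> tensor_space H A"
    using carrier_space_minus[OF carrier_space_tensor, of s H A t] s t
    by (simp add: carrier_tensor_algebra)
  moreover have "operator (s - t) D = 0" if "D \<in> carrier A" for D
    using linear_on_carrier_minus[OF carrier_space_tensor operator_linear[OF that], of s t] s t eq that
    by (simp add: carrier_tensor_algebra)
  ultimately show ?thesis using faithful by fastforce
qed

text \<open>
  A faithful action identifies tensors with their operators, so the algebra axioms are inherited
  from the composition of linear maps.
\<close>

lemma smash_product_algebra: "is_algebra (smash_product H A act)"
proof -
  let ?M = "mult (smash_product H A act)"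
  note T = carrier_space_tensor[of H A]
  have op_add_right: "operator t (x + y) = operator t x + operator t y"
    and op_scale_right: "operator t (smul A c x) = smul A c (operator t x)"
    if "t \<in> tensor_space H A" "x \<in> carrier A" "y \<in> carrier A" for t x y c
    using linear_on_carrier_add[OF operator_linear_right] that
      linear_on_carrier_smul[OF operator_linear_right] by simp_all
  note simps = operator_smash_mult smash_mult_closed tensor_space_add tensor_space_fscale
    operator_add operator_smul op_add_right
    op_scale_right operator_closed
  have one: "tens H A (unity H) (unity A) \<in> tensor_space H A"
    by (intro operator_intros)
  have "bilinear_on_carriers (smash_product H A act) (smash_product H A act) fscale ?M"
    by (intro bilinear_on_carriersI linear_on_carrierI)
      (auto simp: smash_product_simps simps intro!: operator_inject)
  moreover have "?M (?M a b) c = ?M a (?M b c)"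
    if "a \<in> tensor_space H A" "b \<in> tensor_space H A" "c \<in> tensor_space H A" for a b c
    using that by (intro operator_inject) (simp_all add: simps)
  moreover have "?M (tens H A (unity H) (unity A)) a = a" "?M a (tens H A (unity H) (unity A)) = a"
    if "a \<in> tensor_space H A" for a
    using that one
    by (auto intro!: operator_inject
      simp: simps operator_tens H_unity_closed unity_closed act_unity mult_unity)
  ultimately show ?thesis
    using T one smash_mult_closed
    by (simp add: is_algebra_def smash_product_simps vector_space_fscale carrier_space_def
      carrier_tensor_algebra smul_tensor_algebra)
qed

end


section \<open>Coactions representing left multiplications\<close>

text \<open>
  The condition \<open>\<Sum> (D \<triangleleft> a\<^bsub>[-1]\<^esub>) a\<^bsub>[0]\<^esub> = a D\<close> of braided commutativity says that the operator of
  \<open>\<lambda>(a)\<close> is left multiplication by \<open>a\<close>. For a faithful action it determines \<open>\<lambda>\<close> and implies all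
  other properties of a Yetter-Drinfeld module algebra, since the tensors to be compared have
  the same operators.
\<close>

locale regular_coaction = faithful_hopf_action H A act
  for H :: "('k::field, 'h::ab_group_add, 'n) hopf_scheme"
    and A :: "('k, 'a::ab_group_add, 'm) algebra_scheme" and act +
  fixes lam :: "'a \<Rightarrow> ('k, 'h, 'a) tensor"
  assumes lam_closed: "a \<in> carrier A \<Longrightarrow> lam a \<in> tensor_space H A"
    and operator_lam: "a \<in> carrier A \<Longrightarrow> D \<in> carrier A \<Longrightarrow> operator (lam a) D = mult A a D"
begin

lemma lam_linear: "linear_on_carrier A fscale lam"
proof (rule linear_on_carrierI; rule operator_inject)
  fix x y c D assume xy: "x \<in> carrier A" "y \<in> carrier A" and D: "D \<in> carrier A"
  note lin = linear_on_carrier_add[OF bilinear_compose_left[OF mult_bilinear linear_ident, of D]]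
    linear_on_carrier_smul[OF bilinear_compose_left[OF mult_bilinear linear_ident, of D]]
  show "operator (lam (x + y)) D = operator (lam x + lam y) D"
    using xy D lin by (simp add: operator_lam operator_add lam_closed carrier_space_add[OF A_space])
  show "operator (lam (smul A c x)) D = operator (fscale c (lam x)) D"
    using xy D lin by (simp add: operator_lam operator_smul lam_closed carrier_space_smul[OF A_space])
qed (use carrier_space_add[OF carrier_space_tensor, of _ H A] carrier_space_smul[OF carrier_space_tensor, of _ H A] in
    \<open>auto simp: lam_closed carrier_space_add[OF A_space] carrier_space_smul[OF A_space]
      carrier_tensor_algebra smul_tensor_algebra\<close>)

lemma lam_compose:
  "linear_on_carrier P (smul A) f \<Longrightarrow> (\<And>x. x \<in> carrier P \<Longrightarrow> f x \<in> carrier A) \<Longrightarrow>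
    linear_on_carrier P fscale (\<lambda>x. lam (f x))"
  by (rule linear_on_carrier_compose[OF _ _ lam_linear])

lemmas lam_intros = operator_intros lam_closed lam_compose

lemma lam_antihom: "is_unital_antihom A (smash_product H A act) lam"
proof -
  have "lam (mult A a b) = mult (smash_product H A act) (lam b) (lam a)"
    if "a \<in> carrier A" "b \<in> carrier A" for a b
    using that by (intro operator_inject)
      (simp_all add: operator_lam operator_smash_mult smash_mult_closed lam_closed mult_closed mult_assoc)
  moreover have "lam (unity A) = tens H A (unity H) (unity A)"
    by (rule operator_inject)
      (simp_all add: operator_lam operator_tens lam_closed unity_closed H_unity_closed act_unity
        mult_unity tens_in_tensor_space)
  ultimately show ?thesis
    by (simp add: is_unital_antihom_def smash_product_simps lam_closed lam_linear)
qed

lemma braided_commutative: "is_braided_commutative H A act lam"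
  using operator_lam by (simp add: is_braided_commutative_def operator_def)

text \<open>
  Both sides represent \<open>D \<mapsto> (a D) \<triangleleft> h\<close>: the left one acts by \<open>h\<close> after multiplying by \<open>a\<close>, the right
  one gives \<open>\<Sum> (a \<triangleleft> h\<^sub>1) (D \<triangleleft> h\<^sub>2)\<close>.
\<close>

lemma coaction_yetter_drinfeld:
  assumes a: "a \<in> carrier A" and h: "h \<in> carrier H"
  shows "sweedler H A (\<lambda>a1 a0. sweedler H H (\<lambda>h1 h2.
          tens H A (mult H a1 h1) (act a0 h2)) (comult H h)) (lam a)
      = sweedler H H (\<lambda>h1 h2. sweedler H A (\<lambda>a1 a0.
          tens H A (mult H h2 a1) a0) (lam (act a h1))) (comult H h)"
    (is "?L = ?R")
proof (rule operator_inject)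
  show "?L \<in> tensor_space H A" "?R \<in> tensor_space H A"
    by (intro a h lam_intros | assumption)+
  fix D assume D: "D \<in> carrier A"
  have L1: "operator (sweedler H H (\<lambda>h1 h2. tens H A (mult H a1 h1) (act a0 h2)) (comult H h)) D
     = act (mult A (act D a1) a0) h" if m: "a1 \<in> carrier H" "a0 \<in> carrier A" for a1 a0
  proof -
    have "operator (sweedler H H (\<lambda>h1 h2. tens H A (mult H a1 h1) (act a0 h2)) (comult H h)) D
       = sweedler H H (\<lambda>h1 h2. operator (tens H A (mult H a1 h1) (act a0 h2)) D) (comult H h)"
      by (rule operator_sweedler) (intro m h D lam_intros | assumption)+
    also have "\<dots> = sweedler H H (\<lambda>h1 h2. mult A (act (act D a1) h1) (act a0 h2)) (comult H h)"
      by (rule sweedler_cong) (simp add: m D operator_tens act_mult act_closed H_mult_closed)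
    also have "\<dots> = act (mult A (act D a1) a0) h"
      using m h D by (simp add: mult_act act_closed)
    finally show ?thesis .
  qed
  have "operator ?L D = sweedler H A (\<lambda>a1 a0. operator (sweedler H H
      (\<lambda>h1 h2. tens H A (mult H a1 h1) (act a0 h2)) (comult H h)) D) (lam a)"
    by (rule operator_sweedler) (intro a h D lam_intros | assumption)+
  also have "\<dots> = sweedler H A (\<lambda>a1 a0. act (mult A (act D a1) a0) h) (lam a)"
    by (rule sweedler_cong) (rule L1)
  also have "\<dots> = act (operator (lam a) D) h"
    unfolding operator_def
    by (rule linear_sweedler_push[where L = "\<lambda>x. act x h" and s = "smul A" and W = A, symmetric])
      (intro a h D lam_intros | assumption)+
  also have "\<dots> = act (mult A a D) h" using a D by (simp add: operator_lam)
  finally have L: "operator ?L D = act (mult A a D) h" .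
  have R1: "operator (sweedler H A (\<lambda>a1 a0. tens H A (mult H h2 a1) a0) (lam (act a h1))) D
     = mult A (act a h1) (act D h2)" if m: "h1 \<in> carrier H" "h2 \<in> carrier H" for h1 h2
  proof -
    have "operator (sweedler H A (\<lambda>a1 a0. tens H A (mult H h2 a1) a0) (lam (act a h1))) D
      = sweedler H A (\<lambda>a1 a0. operator (tens H A (mult H h2 a1) a0) D) (lam (act a h1))"
      by (rule operator_sweedler) (intro m a h D lam_intros | assumption)+
    also have "\<dots> = operator (lam (act a h1)) (act D h2)"
      unfolding operator_def[of "lam _"]
      by (rule sweedler_cong) (simp add: m D operator_tens act_mult H_mult_closed)
    finally show ?thesis using m a D by (simp add: operator_lam act_closed)
  qed
  have "operator ?R D = sweedler H H (\<lambda>h1 h2. operator (sweedler H A (\<lambda>a1 a0.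
          tens H A (mult H h2 a1) a0) (lam (act a h1))) D) (comult H h)"
    by (rule operator_sweedler) (intro a h D lam_intros | assumption)+
  also have "\<dots> = sweedler H H (\<lambda>h1 h2. mult A (act a h1) (act D h2)) (comult H h)"
    by (rule sweedler_cong) (rule R1)
  also have "\<dots> = act (mult A a D) h" using a h D by (simp add: mult_act)
  finally show "operator ?L D = operator ?R D" using L by simp
qed

text \<open>
  The product on the right is taken in \<open>H\<^sup>o\<^sup>p \<otimes> A\<close> and not in the smash product. Its operator
  sends \<open>D\<close> to \<open>\<Sum> ((D \<triangleleft> b\<^bsub>[-1]\<^esub>) \<triangleleft> a\<^bsub>[-1]\<^esub>) a\<^bsub>[0]\<^esub> b\<^bsub>[0]\<^esub> = \<Sum> a (D \<triangleleft> b\<^bsub>[-1]\<^esub>) b\<^bsub>[0]\<^esub> = a b D\<close>; the sum over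
  \<open>\<lambda>(a)\<close> has to be evaluated first.
\<close>

lemma coaction_mult:
  assumes a: "a \<in> carrier A" and b: "b \<in> carrier A"
  shows "lam (mult A a b) = sweedler H A (\<lambda>a1 a0. sweedler H A (\<lambda>b1 b0.
          tens H A (mult H b1 a1) (mult A a0 b0)) (lam b)) (lam a)" (is "?L = ?R")
proof (rule operator_inject)
  show "?L \<in> tensor_space H A" "?R \<in> tensor_space H A"
    by (intro a b lam_intros | assumption)+
  fix D assume D: "D \<in> carrier A"
  have 1: "operator (sweedler H A (\<lambda>b1 b0. tens H A (mult H b1 a1) (mult A a0 b0)) (lam b)) D
     = sweedler H A (\<lambda>b1 b0. mult A (mult A (act (act D b1) a1) a0) b0) (lam b)"
    if m: "a1 \<in> carrier H" "a0 \<in> carrier A" for a1 a0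
  proof -
    have "operator (sweedler H A (\<lambda>b1 b0. tens H A (mult H b1 a1) (mult A a0 b0)) (lam b)) D
      = sweedler H A (\<lambda>b1 b0. operator (tens H A (mult H b1 a1) (mult A a0 b0)) D) (lam b)"
      by (rule operator_sweedler) (intro m a b D lam_intros | assumption)+
    also have "\<dots> = sweedler H A (\<lambda>b1 b0. mult A (mult A (act (act D b1) a1) a0) b0) (lam b)"
      by (rule sweedler_cong)
        (simp add: m D operator_tens act_mult act_closed H_mult_closed mult_closed mult_assoc)
    finally show ?thesis .
  qed
  have 2: "sweedler H A (\<lambda>a1 a0. mult A (mult A (act (act D b1) a1) a0) b0) (lam a)
     = mult A (mult A a (act D b1)) b0" if m: "b1 \<in> carrier H" "b0 \<in> carrier A" for b1 b0
  proof -
    have "sweedler H A (\<lambda>a1 a0. mult A (mult A (act (act D b1) a1) a0) b0) (lam a)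
      = mult A (operator (lam a) (act D b1)) b0"
      unfolding operator_def
      by (rule linear_sweedler_push[where L = "\<lambda>x. mult A x b0" and s = "smul A" and W = A, symmetric])
        (intro m a b D lam_intros | assumption)+
    then show ?thesis using m a D by (simp add: operator_lam act_closed)
  qed
  have "operator ?R D = sweedler H A (\<lambda>a1 a0. operator (sweedler H A (\<lambda>b1 b0.
          tens H A (mult H b1 a1) (mult A a0 b0)) (lam b)) D) (lam a)"
    by (rule operator_sweedler) (intro a b D lam_intros | assumption)+
  also have "\<dots> = sweedler H A (\<lambda>a1 a0.
      sweedler H A (\<lambda>b1 b0. mult A (mult A (act (act D b1) a1) a0) b0) (lam b)) (lam a)"
    by (rule sweedler_cong) (rule 1)
  also have "\<dots> = sweedler H A (\<lambda>b1 b0.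
      sweedler H A (\<lambda>a1 a0. mult A (mult A (act (act D b1) a1) a0) b0) (lam a)) (lam b)"
    by (rule sweedler_swap[where s = "smul A"]) (intro a b D lam_intros | assumption)+
  also have "\<dots> = sweedler H A (\<lambda>b1 b0. mult A a (mult A (act D b1) b0)) (lam b)"
    by (rule sweedler_cong) (simp add: 2 a D mult_assoc act_closed)
  also have "\<dots> = mult A a (operator (lam b) D)"
    unfolding operator_def
    by (rule linear_sweedler_push[where L = "\<lambda>x. mult A a x" and s = "smul A" and W = A, symmetric])
      (intro a b D lam_intros | assumption)+
  also have "\<dots> = operator ?L D"
    using a b D by (simp add: operator_lam mult_assoc mult_closed)
  finally show "operator ?L D = operator ?R D" by simp
qed

text \<open>
  The bilinear operator \<open>(D, D') \<mapsto> (D \<triangleleft> h) t(D')\<close> of \<open>h \<otimes> t\<close>, where \<open>t(D')\<close> is the value of the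
  operator of \<open>t\<close>. Coassociativity of \<open>\<lambda>\<close>, an equation in \<open>H \<otimes> (H \<otimes> A)\<close>, is tested on these.
\<close>

definition operator2 :: "('k, 'h, ('k, 'h, 'a) tensor) tensor \<Rightarrow> 'a \<Rightarrow> 'a \<Rightarrow> 'a"
  where "operator2 T D D' = sweedler H (tensor_algebra H A) (\<lambda>h t. mult A (act D h) (operator t D')) T"

lemma operator2_linear:
  "D \<in> carrier A \<Longrightarrow> D' \<in> carrier A \<Longrightarrow>
    linear_on_carrier (tensor_algebra H (tensor_algebra H A)) (smul A) (\<lambda>T. operator2 T D D')"
  unfolding operator2_def
  by (intro lam_intros | assumption | erule tensor_carrierD)+

lemma operator2_tens:
  assumes "h \<in> carrier H" "t \<in> tensor_space H A" "D \<in> carrier A" "D' \<in> carrier A"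
  shows "operator2 (tens H (tensor_algebra H A) h t) D D' = mult A (act D h) (operator t D')"
proof -
  have t: "t \<in> carrier (tensor_algebra H A)" using assms(2) by (simp add: carrier_tensor_algebra)
  show ?thesis
    unfolding operator2_def
    by (rule sweedler_tens[of H "tensor_algebra H A" "smul A"])
      (intro lam_intros assms t | assumption | erule tensor_carrierD)+
qed

text \<open>
  Write the difference as \<open>\<Sum> e \<otimes> g\<^sub>e\<close> with independent \<open>e\<close>. For fixed \<open>D'\<close> faithfulness gives
  \<open>\<Sum> e \<otimes> g\<^sub>e(D') = 0\<close>, so \<open>g\<^sub>e(D') = 0\<close> by independence, and \<open>g\<^sub>e = 0\<close> by faithfulness again.
\<close>

lemma operator2_inject:
  assumes T: "T \<in> tensor_space H (tensor_algebra H A)" "T' \<in> tensor_space H (tensor_algebra H A)"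
    and eq: "\<And>D D'. D \<in> carrier A \<Longrightarrow> D' \<in> carrier A \<Longrightarrow> operator2 T D D' = operator2 T' D D'"
  shows "T = T'"
proof -
  let ?TA = "tensor_algebra H A"
  have "T - T' \<in> tensor_space H ?TA"
    using carrier_space_minus[OF carrier_space_tensor, of T H ?TA T'] T
    by (simp add: carrier_tensor_algebra)
  from tensor_space_rep_independent[OF H_space carrier_space_tensor this, unfolded carrier_tensor_algebra]
  obtain E g where E: "finite E" "E \<subseteq> carrier H" "\<not> module.dependent (smul H) E"
    and g: "\<And>e. e \<in> E \<Longrightarrow> g e \<in> tensor_space H A"
    and rep: "T - T' = (\<Sum>e\<in>E. tens H ?TA e (g e))" by blast
  have "operator (g e) D' = 0" if D': "D' \<in> carrier A" and e: "e \<in> E" for e D'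
  proof -
    let ?z = "\<lambda>e. tens H A e (operator (g e) D')"
    have z: "?z e \<in> tensor_space H A" if "e \<in> E" for e
      using that E(2) g D' by (blast intro: tens_in_tensor_space operator_closed)
    have "(\<Sum>e\<in>E. ?z e) = 0"
    proof (rule faithful)
      show "(\<Sum>e\<in>E. ?z e) \<in> tensor_space H A"
        using carrier_space_sum[OF carrier_space_tensor[of H A], of E ?z] z
        by (simp add: carrier_tensor_algebra)
      fix D assume D: "D \<in> carrier A"
      have "operator (\<Sum>e\<in>E. ?z e) D = (\<Sum>e\<in>E. operator (?z e) D)"
        using z by (intro linear_on_carrier_sum[OF carrier_space_tensor operator_linear[OF D]])
          (simp add: carrier_tensor_algebra)
      also have "\<dots> = (\<Sum>e\<in>E. operator2 (tens H ?TA e (g e)) D D')"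
        using E g D D' by (intro sum.cong) (auto simp: operator_tens operator2_tens operator_closed)
      also have "\<dots> = operator2 (T - T') D D'"
        unfolding rep using E g
        by (intro linear_on_carrier_sum[OF carrier_space_tensor operator2_linear[OF D D'], symmetric])
          (auto simp: carrier_tensor_algebra intro: tens_in_tensor_space2)
      also have "\<dots> = 0"
        using linear_on_carrier_minus[OF carrier_space_tensor operator2_linear[OF D D'], of T T'] T
          eq[OF D D'] by (simp add: carrier_tensor_algebra)
      finally show "operator (\<Sum>e\<in>E. ?z e) D = 0" .
    qed
    from sum_tens_independent_eq_0[OF H_space A_space E(1,3) this e] show ?thesis .
  qed
  then have "g e = 0" if "e \<in> E" for e using faithful[OF g[OF that]] that by blast
  then show ?thesis using rep by (simp add: tens_zero_right)
qed

lemma operator2_sweedler: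
  assumes "carrier_space P" "carrier_space Q" "bilinear_on_carriers P Q fscale \<phi>"
    "\<And>a b. a \<in> carrier P \<Longrightarrow> b \<in> carrier Q \<Longrightarrow> \<phi> a b \<in> tensor_space H (tensor_algebra H A)"
    "t \<in> tensor_space P Q" "D \<in> carrier A" "D' \<in> carrier A"
  shows "operator2 (sweedler P Q \<phi> t) D D' = sweedler P Q (\<lambda>a b. operator2 (\<phi> a b) D D') t"
  by (rule linear_sweedler_push_tensor[OF assms(1-4) _ operator2_linear[OF assms(6,7)] assms(5)])
    (assumption | rule carrier_space_vector_space[OF A_space])+

text \<open>
  Both sides send \<open>(D, D')\<close> to \<open>a D D'\<close>. On the left this is the operator of \<open>\<lambda>(a)\<close> at the product
  \<open>D D'\<close>, on the right left multiplication is applied twice.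
\<close>

lemma coaction_coassoc:
  assumes a: "a \<in> carrier A"
  shows "sweedler H A (\<lambda>h b. sweedler H H (\<lambda>h1 h2.
          tens H (tensor_algebra H A) h1 (tens H A h2 b)) (comult H h)) (lam a)
      = sweedler H A (\<lambda>h b. tens H (tensor_algebra H A) h (lam b)) (lam a)" (is "?L = ?R")
proof (rule operator2_inject)
  show "?L \<in> tensor_space H (tensor_algebra H A)" "?R \<in> tensor_space H (tensor_algebra H A)"
    by (intro a lam_intros | assumption)+
  fix D D' assume D: "D \<in> carrier A" "D' \<in> carrier A"
  have 1: "operator2 (sweedler H H (\<lambda>h1 h2. tens H (tensor_algebra H A) h1 (tens H A h2 b)) (comult H h)) D D'
      = mult A (act (mult A D D') h) b" if m: "h \<in> carrier H" "b \<in> carrier A" for h b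
  proof -
    have "operator2 (sweedler H H (\<lambda>h1 h2. tens H (tensor_algebra H A) h1 (tens H A h2 b)) (comult H h)) D D'
      = sweedler H H (\<lambda>h1 h2. operator2 (tens H (tensor_algebra H A) h1 (tens H A h2 b)) D D') (comult H h)"
      by (rule operator2_sweedler) (intro m a D lam_intros | assumption)+
    also have "\<dots> = sweedler H H (\<lambda>h1 h2. mult A (act D h1) (mult A (act D' h2) b)) (comult H h)"
      by (rule sweedler_cong) (simp add: operator2_tens operator_tens tens_in_tensor_space m D)
    also have "\<dots> = mult A (act (mult A D D') h) b"
      using D m by (intro action_product)
    finally show ?thesis .
  qed
  have "operator2 ?L D D' = sweedler H A (\<lambda>h b. operator2 (sweedler H H (\<lambda>h1 h2.
          tens H (tensor_algebra H A) h1 (tens H A h2 b)) (comult H h)) D D') (lam a)"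
    by (rule operator2_sweedler) (intro a D lam_intros | assumption)+
  also have "\<dots> = operator (lam a) (mult A D D')"
    unfolding operator_def by (rule sweedler_cong) (rule 1)
  also have "\<dots> = mult A (operator (lam a) D) D'"
    using a D by (simp add: operator_lam mult_closed mult_assoc)
  also have "\<dots> = sweedler H A (\<lambda>h b. mult A (mult A (act D h) b) D') (lam a)"
    unfolding operator_def
    by (rule linear_sweedler_push[where L = "\<lambda>x. mult A x D'" and s = "smul A" and W = A])
      (intro a D lam_intros | assumption)+
  also have "\<dots> = sweedler H A (\<lambda>h b. operator2 (tens H (tensor_algebra H A) h (lam b)) D D') (lam a)"
    by (rule sweedler_cong)
      (simp add: operator2_tens lam_closed operator_lam D mult_assoc act_closed)
  also have "\<dots> = operator2 ?R D D'"
    by (rule operator2_sweedler[symmetric]) (intro a D lam_intros | assumption)+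
  finally show "operator2 ?L D D' = operator2 ?R D D'" .
qed

text \<open>
  Since \<open>1 \<triangleleft> h = \<epsilon>(h) 1\<close>, the left-hand side is the operator of \<open>\<lambda>(a)\<close> evaluated at \<open>1\<close>.
\<close>

lemma coaction_counit:
  assumes a: "a \<in> carrier A"
  shows "sweedler H A (\<lambda>h b. smul A (counit H h) b) (lam a) = a"
proof -
  have "sweedler H A (\<lambda>h b. smul A (counit H h) b) (lam a) = operator (lam a) (unity A)"
    unfolding operator_def
  proof (rule sweedler_cong)
    fix h b assume "h \<in> carrier H" "b \<in> carrier A"
    then show "smul A (counit H h) b = mult A (act (unity A) h) b"
      using linear_on_carrier_smul[OF bilinear_compose_left[OF mult_bilinear linear_ident, of b], of "unity A"]
      by (simp add: unity_act unity_closed mult_unity)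
  qed
  then show ?thesis using a by (simp add: operator_lam unity_closed mult_unity)
qed

theorem yetter_drinfeld_module_algebra: "is_yetter_drinfeld_module_algebra H A act lam"
  using bialgebra algebra hopf_action lam_closed lam_linear coaction_coassoc coaction_counit
    coaction_yetter_drinfeld coaction_mult lam_antihom
  unfolding is_yetter_drinfeld_module_algebra_def is_left_comodule_def is_unital_antihom_def
    smash_product_simps by blast

end


section \<open>Coactions from generators\<close>

text \<open>
  All of the algebra is spanned by words in the set, phrased as induction along left
  multiplication.
\<close>

definition left_generates :: "('k::field, 'a::ab_group_add, 'm) algebra_scheme \<Rightarrow> 'a set \<Rightarrow> bool"
  where "left_generates A G \<longleftrightarrow> G \<subseteq> carrier A \<and>
    (\<forall>V. module.subspace (smul A) V \<and> V \<subseteq> carrier A \<and> unity A \<in> V \<and>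
      (\<forall>x\<in>G. \<forall>D\<in>V. mult A x D \<in> V) \<longrightarrow> carrier A \<subseteq> V)"

lemma left_generates_induct:
  assumes "left_generates A G" and A: "carrier_space A" and a: "a \<in> carrier A" and "P (unity A)" "unity A \<in> carrier A"
    and "\<And>x y. x \<in> carrier A \<Longrightarrow> y \<in> carrier A \<Longrightarrow> P x \<Longrightarrow> P y \<Longrightarrow> P (x + y)"
    and "\<And>c x. x \<in> carrier A \<Longrightarrow> P x \<Longrightarrow> P (smul A c x)"
    and "\<And>x D. x \<in> G \<Longrightarrow> D \<in> carrier A \<Longrightarrow> P D \<Longrightarrow> P (mult A x D)"
    and "\<And>x D. x \<in> G \<Longrightarrow> D \<in> carrier A \<Longrightarrow> mult A x D \<in> carrier A"
  shows "P a"
proof -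
  interpret vector_space "smul A" using A by (rule carrier_space_vector_space)
  let ?V = "{a \<in> carrier A. P a}"
  have "P 0" using assms(7)[of "unity A" 0] assms(4,5) by simp
  then have "subspace ?V"
    using assms(6,7) carrier_space_0[OF A] carrier_space_add[OF A] carrier_space_smul[OF A]
    by (intro subspaceI) auto
  then have "carrier A \<subseteq> ?V"
    using assms(1,4,5,8,9) unfolding left_generates_def by blast
  then show ?thesis using a by blast
qed

context faithful_hopf_action
begin

lemma mult_add_left: "x \<in> carrier A \<Longrightarrow> y \<in> carrier A \<Longrightarrow> D \<in> carrier A \<Longrightarrow>
    mult A (x + y) D = mult A x D + mult A y D"
  and mult_smul_left: "x \<in> carrier A \<Longrightarrow> D \<in> carrier A \<Longrightarrow> mult A (smul A c x) D = smul A c (mult A x D)"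
  using mult_bilinear by (simp_all add: bilinear_on_carriers_def linear_on_carrier_def)

lemma operator_one: "D \<in> carrier A \<Longrightarrow> operator (tens H A (unity H) (unity A)) D = D"
  by (simp add: operator_tens H_unity_closed unity_closed act_unity mult_unity)

text \<open>
  Operators reverse products as well, so \<open>a \<mapsto> operator (lam a)\<close> is multiplicative, just as
  \<open>a \<mapsto> (D \<mapsto> a D)\<close> is; two such maps agree once they agree on generators. This gives the uniqueness
  of the coaction.
\<close>

lemma antihom_operator:
  assumes gen: "left_generates A G" and lam: "is_unital_antihom A (smash_product H A act) lam"
    and G: "\<And>x D. x \<in> G \<Longrightarrow> D \<in> carrier A \<Longrightarrow> operator (lam x) D = mult A x D"
    and a: "a \<in> carrier A"
  shows "\<forall>D\<in>carrier A. operator (lam a) D = mult A a D"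
proof (rule left_generates_induct[OF gen A_space a])
  have cl: "lam x \<in> tensor_space H A" if "x \<in> carrier A" for x
    using lam that by (simp add: is_unital_antihom_def smash_product_simps)
  show "unity A \<in> carrier A" by (rule unity_closed)
  show "\<forall>D\<in>carrier A. operator (lam (unity A)) D = mult A (unity A) D"
    using lam by (simp add: is_unital_antihom_def smash_product_simps operator_one mult_unity)
  fix x y assume "x \<in> carrier A" "y \<in> carrier A"
    "\<forall>D\<in>carrier A. operator (lam x) D = mult A x D" "\<forall>D\<in>carrier A. operator (lam y) D = mult A y D"
  then show "\<forall>D\<in>carrier A. operator (lam (x + y)) D = mult A (x + y) D"
    using lam by (simp add: is_unital_antihom_def linear_on_carrier_def cl operator_add mult_add_left)
next
  have cl: "lam x \<in> tensor_space H A" if "x \<in> carrier A" for x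
    using lam that by (simp add: is_unital_antihom_def smash_product_simps)
  fix c x assume "x \<in> carrier A" "\<forall>D\<in>carrier A. operator (lam x) D = mult A x D"
  then show "\<forall>D\<in>carrier A. operator (lam (smul A c x)) D = mult A (smul A c x) D"
    using lam by (simp add: is_unital_antihom_def linear_on_carrier_def cl operator_smul mult_smul_left
        smash_product_simps)
next
  have cl: "lam x \<in> tensor_space H A" if "x \<in> carrier A" for x
    using lam that by (simp add: is_unital_antihom_def smash_product_simps)
  have GA: "x \<in> carrier A" if "x \<in> G" for x using gen that by (auto simp: left_generates_def)
  fix x D assume x: "x \<in> G" "D \<in> carrier A"
  then show "mult A x D \<in> carrier A" using GA mult_closed by blast
  assume "\<forall>E\<in>carrier A. operator (lam D) E = mult A D E"
  then show "\<forall>E\<in>carrier A. operator (lam (mult A x D)) E = mult A (mult A x D) E"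
    using lam x GA by (simp add: is_unital_antihom_def operator_smash_mult cl G mult_closed mult_assoc)
qed

text \<open>
  Products in the smash product represent compositions, so the elements whose left
  multiplication has a tensor are closed under products. This gives the existence of the coaction.
\<close>

lemma left_multiplication_represented:
  assumes gen: "left_generates A G"
    and G: "\<And>x. x \<in> G \<Longrightarrow> \<exists>t\<in>tensor_space H A. \<forall>D\<in>carrier A. operator t D = mult A x D"
    and a: "a \<in> carrier A"
  shows "\<exists>t\<in>tensor_space H A. \<forall>D\<in>carrier A. operator t D = mult A a D"
proof (rule left_generates_induct[OF gen A_space a])
  show "unity A \<in> carrier A" by (rule unity_closed)
  show "\<exists>t\<in>tensor_space H A. \<forall>D\<in>carrier A. operator t D = mult A (unity A) D"
    by (rule bexI[of _ "tens H A (unity H) (unity A)"])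
      (auto simp: operator_one mult_unity tens_in_tensor_space H_unity_closed unity_closed)
  fix x y assume xy: "x \<in> carrier A" "y \<in> carrier A"
    "\<exists>t\<in>tensor_space H A. \<forall>D\<in>carrier A. operator t D = mult A x D"
    "\<exists>t\<in>tensor_space H A. \<forall>D\<in>carrier A. operator t D = mult A y D"
  then obtain s t where "s \<in> tensor_space H A" "t \<in> tensor_space H A"
    "\<forall>D\<in>carrier A. operator s D = mult A x D" "\<forall>D\<in>carrier A. operator t D = mult A y D" by blast
  then show "\<exists>t\<in>tensor_space H A. \<forall>D\<in>carrier A. operator t D = mult A (x + y) D"
    using xy(1,2) by (intro bexI[of _ "s + t"]) (auto simp: operator_add tensor_space_add mult_add_left)
next
  fix c x assume xy: "x \<in> carrier A"
    "\<exists>t\<in>tensor_space H A. \<forall>D\<in>carrier A. operator t D = mult A x D"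
  then obtain s where "s \<in> tensor_space H A" "\<forall>D\<in>carrier A. operator s D = mult A x D" by blast
  then show "\<exists>t\<in>tensor_space H A. \<forall>D\<in>carrier A. operator t D = mult A (smul A c x) D"
    using xy(1) by (intro bexI[of _ "fscale c s"])
      (auto simp: operator_smul tensor_space_fscale mult_smul_left)
next
  have GA: "x \<in> carrier A" if "x \<in> G" for x using gen that by (auto simp: left_generates_def)
  fix x D assume x: "x \<in> G" and D: "D \<in> carrier A"
  then show "mult A x D \<in> carrier A" using GA mult_closed by blast
  assume "\<exists>t\<in>tensor_space H A. \<forall>E\<in>carrier A. operator t E = mult A D E"
  then obtain s t where "s \<in> tensor_space H A" "t \<in> tensor_space H A"
    "\<forall>E\<in>carrier A. operator s E = mult A x E" "\<forall>E\<in>carrier A. operator t E = mult A D E"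
    using G[OF x] by blast
  then show "\<exists>t\<in>tensor_space H A. \<forall>E\<in>carrier A. operator t E = mult A (mult A x D) E"
    using GA[OF x] D by (intro bexI[of _ "mult (smash_product H A act) t s"])
      (auto simp: operator_smash_mult smash_mult_closed mult_closed mult_assoc)
qed

lemma regular_coactionI:
  assumes "\<And>a. a \<in> carrier A \<Longrightarrow> lam a \<in> tensor_space H A"
    and "\<And>a D. a \<in> carrier A \<Longrightarrow> D \<in> carrier A \<Longrightarrow> operator (lam a) D = mult A a D"
  shows "regular_coaction H A act lam"
  using assms faithful_hopf_action_axioms
  by (simp add: regular_coaction_def regular_coaction_axioms_def)

end


section \<open>Functionals on a bialgebra and the induced action\<close>

locale total_bialgebra =
  fixes U :: "('k::field, 'u::ab_group_add) hopf"
  assumes bialgebra: "is_bialgebra U" and carrier_UNIV: "carrier U = UNIV"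
begin

lemma U_algebra: "is_algebra U" using bialgebra by (simp add: is_bialgebra_def)

lemmas U_space = is_algebra_carrier_space[OF U_algebra]
lemmas U_vector_space = carrier_space_vector_space[OF U_space]

lemma mem_carrier: "x \<in> carrier U" by (simp add: carrier_UNIV)

lemma mult_assoc: "mult U (mult U a b) c = mult U a (mult U b c)"
  and mult_unity: "mult U (unity U) a = a" "mult U a (unity U) = a"
  and mult_bilinear: "bilinear_on_carriers U U (smul U) (mult U)"
  using U_algebra by (simp_all add: is_algebra_def carrier_UNIV)

lemma mult_add: "mult U (a + b) c = mult U a c + mult U b c" "mult U a (b + c) = mult U a b + mult U a c"
  and mult_smul: "mult U (smul U r a) b = smul U r (mult U a b)" "mult U a (smul U r b) = smul U r (mult U a b)"
  using mult_bilinear by (simp_all add: bilinear_on_carriers_def linear_on_carrier_def carrier_UNIV)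

lemma mult_sum: "mult U (\<Sum>i\<in>I. f i) b = (\<Sum>i\<in>I. mult U (f i) b)"
    "mult U b (\<Sum>i\<in>I. f i) = (\<Sum>i\<in>I. mult U b (f i))"
  using linear_on_carrier_sum[OF U_space bilinear_compose_left[OF mult_bilinear linear_ident]]
    linear_on_carrier_sum[OF U_space bilinear_compose_right[OF mult_bilinear linear_ident]]
  by (simp_all add: mem_carrier)

lemma comult_closed: "comult U D \<in> tensor_space U U"
  and comult_linear: "linear_on_carrier U fscale (comult U)"
  and comult_unity: "comult U (unity U) = tens U U (unity U) (unity U)"
  and comult_mult: "comult U (mult U D D') = mult (tensor_algebra U U) (comult U D) (comult U D')"
  and counit_unity: "counit U (unity U) = 1"
  and counit_linear: "linear_on_carrier U (*) (counit U)"
  and comult_counit: "sweedler U U (\<lambda>a b. smul U (counit U a) b) (comult U D) = D"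
  and comult_coassoc: "sweedler U U (\<lambda>a b. sweedler U U (\<lambda>a1 a2.
          tens U (tensor_algebra U U) a1 (tens U U a2 b)) (comult U a)) (comult U D)
      = sweedler U U (\<lambda>a b. tens U (tensor_algebra U U) a (comult U b)) (comult U D)"
  using bialgebra by (simp_all add: is_bialgebra_def carrier_UNIV)

lemma comult_compose:
  "linear_on_carrier P (smul U) f \<Longrightarrow> linear_on_carrier P fscale (\<lambda>x. comult U (f x))"
  by (rule linear_on_carrier_compose[OF _ _ comult_linear]) (simp_all add: mem_carrier)

lemma dual_iff: "f \<in> carrier (dual_algebra U) \<longleftrightarrow> linear_on_carrier U (*) f"
  using U_vector_space
  by (simp add: vector_space_mult dual_algebra_def linear_on_carrier_def carrier_UNIV Vector_Spaces.linear_def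
      module_hom_iff module_iff_vector_space)

lemma dual_compose:
  "linear_on_carrier U (*) f \<Longrightarrow> linear_on_carrier P (smul U) g \<Longrightarrow> linear_on_carrier P (*) (\<lambda>x. f (g x))"
  by (rule linear_on_carrier_compose[where W = U]) (simp_all add: mem_carrier)

lemma linear_evaluation: "smul P = fscale \<Longrightarrow> linear_on_carrier P (*) (\<lambda>f. f D)"
  by (simp add: linear_on_carrier_def fscale_def)

lemmas U_intros = multilinear_intros U_space U_vector_space mem_carrier comult_closed comult_compose
  bilinear_compose_left[OF mult_bilinear] bilinear_compose_right[OF mult_bilinear]
  linear_evaluation

lemma sweedler_comult_mult:
  assumes s: "vector_space s" and \<phi>: "bilinear_on_carriers U U s \<phi>"
  shows "sweedler U U \<phi> (comult U (mult U D D')) = sweedler U U (\<lambda>a b.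
    sweedler U U (\<lambda>a' b'. \<phi> (mult U a a') (mult U b b')) (comult U D')) (comult U D)"
proof -
  note lin = U_intros s \<phi> bilinear_compose_left[OF \<phi>] bilinear_compose_right[OF \<phi>] linear_sweedler[OF U_space U_space s \<phi>]
  have "sweedler U U \<phi> (comult U (mult U D D')) = sweedler U U \<phi> (sweedler U U (\<lambda>a b. sweedler U U (\<lambda>a' b'.
      tens U U (mult U a a') (mult U b b')) (comult U D')) (comult U D))"
    by (simp add: comult_mult tensor_algebra_def)
  also have "\<dots> = sweedler U U (\<lambda>a b. sweedler U U \<phi> (sweedler U U (\<lambda>a' b'.
      tens U U (mult U a a') (mult U b b')) (comult U D'))) (comult U D)"
    by (rule linear_sweedler_push_tensor[where X = U and Y = U and s = s]) (intro lin | assumption)+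
  also have "\<dots> = sweedler U U (\<lambda>a b. sweedler U U (\<lambda>a' b'. sweedler U U \<phi>
      (tens U U (mult U a a') (mult U b b'))) (comult U D')) (comult U D)"
    by (intro sweedler_cong linear_sweedler_push_tensor[where X = U and Y = U and s = s])
      (intro lin | assumption)+
  also have "\<dots> = sweedler U U (\<lambda>a b.
    sweedler U U (\<lambda>a' b'. \<phi> (mult U a a') (mult U b b')) (comult U D')) (comult U D)"
    by (intro sweedler_cong sweedler_tens[OF U_space U_space s \<phi>] mem_carrier)
  finally show ?thesis .
qed

abbreviation act where "act \<equiv> induced_action U"

lemma act_linear:
  assumes f: "linear_on_carrier U (*) f"
  shows "linear_on_carrier U (smul U) (\<lambda>D. act D f)"
  unfolding induced_action_def by (intro U_intros dual_compose[OF f] | assumption)+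

lemma act_unity_left:
  assumes f: "linear_on_carrier U (*) f"
  shows "act (unity U) f = smul U (f (unity U)) (unity U)"
  unfolding induced_action_def comult_unity
  by (rule sweedler_tens[where s = "smul U"]) (intro U_intros dual_compose[OF f] | assumption)+

lemma functional_act:
  assumes f: "linear_on_carrier U (*) f" and h: "linear_on_carrier U (*) h"
  shows "h (act D f) = mult (dual_algebra U) f h D"
proof -
  have "h (act D f) = sweedler U U (\<lambda>D1 D2. h (smul U (f D1) D2)) (comult U D)"
    unfolding induced_action_def
    by (rule linear_sweedler_push[where s = "(*)" and W = U])
      (intro U_intros dual_compose[OF f] h | assumption)+
  also have "\<dots> = mult (dual_algebra U) f h D"
    using h by (simp add: dual_algebra_def linear_on_carrier_smul mem_carrier)
  finally show ?thesis .
qed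

lemma act_counit: "act D (counit U) = D"
  by (simp add: induced_action_def comult_counit)

text \<open>
  By coassociativity both sides are \<open>\<Sum> f(D\<^sub>1) h(D\<^sub>2) D\<^sub>3\<close>. Coassociativity is an equation of
  tensors in \<open>U \<otimes> (U \<otimes> U)\<close>, to which the linear map \<open>a \<otimes> b \<otimes> c \<mapsto> f(a) h(b) c\<close> is applied.
\<close>

lemma act_act:
  assumes f: "linear_on_carrier U (*) f" and h: "linear_on_carrier U (*) h"
  shows "act (act D f) h = act D (mult (dual_algebra U) f h)"
proof -
  define \<phi> where "\<phi> = (\<lambda>a t. smul U (f a) (sweedler U U (\<lambda>b c. smul U (h b) c) t))"
  let ?T = "tensor_algebra U U"
  have \<phi>: "bilinear_on_carriers U ?T (smul U) \<phi>"
    unfolding \<phi>_def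
    by (intro U_intros dual_compose[OF f] dual_compose[OF h] | assumption | erule tensor_carrierD)+
  note lin = U_intros dual_compose[OF f] dual_compose[OF h] linear_sweedler[OF U_space carrier_space_tensor _ \<phi>]
    bilinear_compose_left[OF \<phi>] bilinear_compose_right[OF \<phi>]
  note L = linear_sweedler[OF U_space carrier_space_tensor U_vector_space \<phi>]
  have T: "sweedler U ?T \<phi> (tens U ?T a t) = \<phi> a t" if "t \<in> tensor_space U U" for a t
    using that by (intro sweedler_tens[OF U_space carrier_space_tensor U_vector_space \<phi>])
      (auto simp: mem_carrier carrier_tensor_algebra)
  have "act (act D f) h = sweedler U U (\<lambda>a b. act (smul U (f a) b) h) (comult U D)"
    unfolding induced_action_def[of U D f]
    by (rule linear_sweedler_push[where s = "smul U" and W = U])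
      (intro lin act_linear h | assumption)+
  also have "\<dots> = sweedler U U (\<lambda>a b. \<phi> a (comult U b)) (comult U D)"
    using linear_on_carrier_smul[OF act_linear[OF h]]
    by (simp add: mem_carrier \<phi>_def induced_action_def)
  also have "\<dots> = sweedler U U (\<lambda>a b. sweedler U ?T \<phi> (tens U ?T a (comult U b))) (comult U D)"
    by (simp add: T comult_closed)
  also have "\<dots> = sweedler U ?T \<phi> (sweedler U U (\<lambda>a b. tens U ?T a (comult U b)) (comult U D))"
    by (rule linear_sweedler_push_tensor[OF U_space U_space _ _ U_vector_space L, symmetric])
      (intro lin | assumption)+
  also have "\<dots> = sweedler U ?T \<phi> (sweedler U U (\<lambda>a b. sweedler U U (\<lambda>a1 a2.
          tens U ?T a1 (tens U U a2 b)) (comult U a)) (comult U D))"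
    by (simp add: comult_coassoc)
  also have "\<dots> = sweedler U U (\<lambda>a b. sweedler U ?T \<phi> (sweedler U U (\<lambda>a1 a2.
          tens U ?T a1 (tens U U a2 b)) (comult U a))) (comult U D)"
    by (rule linear_sweedler_push_tensor[OF U_space U_space _ _ U_vector_space L])
      (intro lin | assumption)+
  also have "\<dots> = sweedler U U (\<lambda>a b. sweedler U U (\<lambda>a1 a2. sweedler U ?T \<phi> (
          tens U ?T a1 (tens U U a2 b))) (comult U a)) (comult U D)"
    by (intro sweedler_cong linear_sweedler_push_tensor[OF U_space U_space _ _ U_vector_space L])
      (intro lin | assumption)+
  also have "\<dots> = sweedler U U (\<lambda>a b. sweedler U U (\<lambda>a1 a2. smul U (f a1 * h a2) b) (comult U a)) (comult U D)"
  proof (intro sweedler_cong)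
    fix a b a1 a2
    have "sweedler U U (\<lambda>b c. smul U (h b) c) (tens U U a2 b) = smul U (h a2) b"
      by (rule sweedler_tens[OF U_space U_space U_vector_space]) (intro lin | assumption)+
    then show "sweedler U ?T \<phi> (tens U ?T a1 (tens U U a2 b)) = smul U (f a1 * h a2) b"
      using U_vector_space
      by (subst T) (simp_all add: tens_in_tensor_space mem_carrier \<phi>_def vector_space_def)
  qed
  also have "\<dots> = sweedler U U (\<lambda>a b. smul U (sweedler U U (\<lambda>a1 a2. f a1 * h a2) (comult U a)) b) (comult U D)"
    by (intro sweedler_cong smul_sweedler[OF U_space U_space U_vector_space, symmetric])
      (intro lin | assumption)+
  also have "\<dots> = act D (mult (dual_algebra U) f h)"
    by (simp add: induced_action_def dual_algebra_def)
  finally show ?thesis .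
qed

end


section \<open>The comultiplication of the finite dual\<close>

lemma sweedler_sum_tens:
  assumes "carrier_space A" "carrier_space B" "vector_space s" "bilinear_on_carriers A B s \<phi>"
    "\<And>i. i \<in> I \<Longrightarrow> a i \<in> carrier A" "\<And>i. i \<in> I \<Longrightarrow> b i \<in> carrier B"
  shows "sweedler A B \<phi> (\<Sum>i\<in>I. tens A B (a i) (b i)) = (\<Sum>i\<in>I. \<phi> (a i) (b i))"
proof -
  have "sweedler A B \<phi> (\<Sum>i\<in>I. tens A B (a i) (b i)) = (\<Sum>i\<in>I. sweedler A B \<phi> (tens A B (a i) (b i)))"
    using assms(5,6)
    by (intro linear_on_carrier_sum[OF carrier_space_tensor linear_sweedler[OF assms(1-4)]])
      (simp add: carrier_tensor_algebra tens_in_tensor_space)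
  also have "\<dots> = (\<Sum>i\<in>I. \<phi> (a i) (b i))"
    using assms by (intro sum.cong refl sweedler_tens[OF assms(1-4)]) auto
  finally show ?thesis .
qed

context total_bialgebra
begin

abbreviation Dual where "Dual \<equiv> dual_algebra U"

lemma smul_Dual: "smul Dual = fscale" by (simp add: dual_algebra_def)

lemma sum_functionals: "(\<Sum>i\<in>I. f i) x = (\<Sum>i\<in>I. f i x :: 'k)" for f :: "'i \<Rightarrow> 'x \<Rightarrow> 'k"
  by (induction I rule: infinite_finite_induct) auto

lemma Dual_space: "carrier_space Dual"
proof -
  interpret F: vector_space "fscale :: 'k \<Rightarrow> ('u \<Rightarrow> 'k) \<Rightarrow> _" by (rule vector_space_fscale)
  have "F.subspace {f. linear_on_carrier U (*) f}"
    by (intro F.subspaceI)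
      (auto simp: linear_on_carrier_def fscale_def algebra_simps)
  moreover have "carrier Dual = {f. linear_on_carrier U (*) f}" using dual_iff by blast
  ultimately show ?thesis
    using vector_space_fscale by (simp add: carrier_space_def smul_Dual)
qed

lemma evaluation_bilinear:
  assumes "smul A = fscale" "smul B = fscale"
  shows "bilinear_on_carriers A B (*) (\<lambda>f g. f D * g D')"
  using assms by (intro U_intros | assumption)+

text \<open>
  Write the difference as \<open>\<Sum> e \<otimes> g\<^sub>e\<close> with independent functionals \<open>e\<close>. For each \<open>D'\<close> the
  functional \<open>\<Sum> g\<^sub>e(D') e\<close> vanishes, so all \<open>g\<^sub>e(D')\<close> do.
\<close>

lemma dual_tensor_unique:
  assumes t: "t \<in> tensor_space Dual Dual" "t' \<in> tensor_space Dual Dual"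
    and eq: "\<And>D D'. sweedler Dual Dual (\<lambda>f g. f D * g D') t = sweedler Dual Dual (\<lambda>f g. f D * g D') t'"
  shows "t = t'"
proof -
  interpret F: vector_space "fscale :: 'k \<Rightarrow> ('u \<Rightarrow> 'k) \<Rightarrow> _" by (rule vector_space_fscale)
  have "t - t' \<in> tensor_space Dual Dual"
    using carrier_space_minus[OF carrier_space_tensor, of t Dual Dual t'] t
    by (simp add: carrier_tensor_algebra)
  from tensor_space_rep_independent[OF Dual_space Dual_space this]
  obtain E g where E: "finite E" "E \<subseteq> carrier Dual" "\<not> module.dependent (smul Dual) E"
    and g: "\<And>e. e \<in> E \<Longrightarrow> g e \<in> carrier Dual"
    and rep: "t - t' = (\<Sum>e\<in>E. tens Dual Dual e (g e))" by blast
  have "g e D' = 0" if e: "e \<in> E" for e D'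
  proof -
    have "(\<Sum>e\<in>E. e D * g e D') = 0" for D
    proof -
      note bil = evaluation_bilinear[OF smul_Dual smul_Dual, of D D']
      have "(\<Sum>e\<in>E. e D * g e D') = sweedler Dual Dual (\<lambda>f g. f D * g D') (t - t')"
        unfolding rep using E g
        by (intro sweedler_sum_tens[OF Dual_space Dual_space vector_space_mult bil, symmetric]) auto
      also have "\<dots> = 0"
        using linear_on_carrier_minus[OF carrier_space_tensor
            linear_sweedler[OF Dual_space Dual_space vector_space_mult bil], of t t'] t eq
        by (simp add: carrier_tensor_algebra)
      finally show ?thesis .
    qed
    then have "(\<Sum>e\<in>E. fscale (g e D') e) = 0"
      by (simp add: fun_eq_iff sum_functionals fscale_def mult.commute)
    then show ?thesis
      using F.independentD[of E E "\<lambda>e. g e D'" e] E e by (simp add: smul_Dual)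
  qed
  then have "g e = 0" if "e \<in> E" for e using that by (auto simp: fun_eq_iff)
  then show ?thesis using rep by (simp add: tens_zero_right)
qed

text \<open>
  If \<open>f\<close> vanishes on an ideal \<open>I\<close> of finite codimension, choose a basis of the algebra out of \<open>I\<close>
  and finitely many other elements \<open>b\<close>, with coordinate functionals \<open>\<chi>\<^sub>b\<close>. Then
  \<open>D - \<Sum> \<chi>\<^sub>b(D) b\<close> lies in \<open>I\<close>, hence \<open>f(D D') = \<Sum> \<chi>\<^sub>b(D) f(b D')\<close>.
\<close>

lemma dual_tensor_exists:
  assumes "f \<in> carrier (finite_dual U)"
  shows "\<exists>t\<in>tensor_space Dual Dual.
    \<forall>D D'. f (mult U D D') = sweedler Dual Dual (\<lambda>f1 f2. f1 D * f2 D') t"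
proof -
  interpret V: vector_space "smul U" by (rule U_vector_space)
  have f: "linear_on_carrier U (*) f" using assms dual_iff by (simp add: finite_dual_def)
  obtain I B where I: "is_ideal U I" "finite B" "V.span (I \<union> B) = UNIV" "\<forall>x\<in>I. f x = 0"
    using assms by (auto simp: finite_dual_def carrier_UNIV)
  obtain B' where B': "B' \<subseteq> I \<union> B" "V.independent B'" "I \<union> B \<subseteq> V.span B'"
    using V.maximal_independent_subset by blast
  have span: "V.span B' = UNIV"
    using B'(3) I(3) V.span_minimal[OF B'(3) V.subspace_span] by auto
  let ?N = "B' - I"
  have fin: "finite ?N" using B'(1) I(2) by (auto intro: finite_subset[of _ B])
  have P: "vector_space_pair (smul U) ((*) :: 'k \<Rightarrow> 'k \<Rightarrow> 'k)"
    using U_vector_space vector_space_mult by (simp add: vector_space_pair_def)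
  have "\<exists>\<chi>. linear_on_carrier U (*) \<chi> \<and> (\<forall>x\<in>B'. \<chi> x = (if x = b then 1 else 0))" for b
  proof -
    obtain \<chi> where "Vector_Spaces.linear (smul U) (*) \<chi>" "\<forall>x\<in>B'. \<chi> x = (if x = b then 1 else 0 :: 'k)"
      using vector_space_pair.linear_independent_extend[OF P B'(2), of "\<lambda>x. if x = b then 1 else 0"]
      by blast
    then show ?thesis using dual_iff[of \<chi>] by (auto simp: dual_algebra_def)
  qed
  then obtain \<chi> where \<chi>: "\<And>b. linear_on_carrier U (*) (\<chi> b)"
    and \<chi>B: "\<And>b x. x \<in> B' \<Longrightarrow> \<chi> b x = (if x = b then 1 else 0)" by metis
  have fm: "linear_on_carrier U (*) (\<lambda>D'. f (mult U b D'))" for b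
    by (intro U_intros dual_compose[OF f])
  have expand: "f (mult U D D') = (\<Sum>b\<in>?N. \<chi> b D * f (mult U b D'))" for D D'
  proof -
    let ?W = "{D. f (mult U D D') = (\<Sum>b\<in>?N. \<chi> b D * f (mult U b D'))}"
    have f0: "f 0 = 0" and \<chi>0: "\<And>b. \<chi> b 0 = 0"
      using linear_on_carrier_0[OF U_space] f \<chi> by auto
    have m0: "mult U 0 D' = 0" using mult_sum(1)[of _ "{}"] by simp
    have "V.subspace ?W"
      using f \<chi> by (intro V.subspaceI)
        (auto simp: linear_on_carrier_def carrier_UNIV f0 \<chi>0 m0 mult_add mult_smul distrib_right
          sum.distrib sum_distrib_left mult.assoc)
    moreover have "B' \<subseteq> ?W"
    proof
      fix x assume x: "x \<in> B'"
      have "(\<Sum>b\<in>?N. \<chi> b x * f (mult U b D')) = (\<Sum>b\<in>?N. if x = b then f (mult U b D') else 0)"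
        using \<chi>B[OF x] by (intro sum.cong) auto
      also have "\<dots> = (if x \<in> I then 0 else f (mult U x D'))"
        using fin x by simp
      also have "\<dots> = f (mult U x D')"
        using I(1,4) by (auto simp: is_ideal_def carrier_UNIV)
      finally show "x \<in> ?W" by simp
    qed
    ultimately show ?thesis using V.span_minimal[of B' ?W] span by blast
  qed
  let ?t = "\<Sum>b\<in>?N. tens Dual Dual (\<chi> b) (\<lambda>D'. f (mult U b D'))"
  have "?t \<in> carrier (tensor_algebra Dual Dual)"
    using \<chi> fm by (intro carrier_space_sum[OF carrier_space_tensor])
      (simp add: carrier_tensor_algebra tens_in_tensor_space dual_iff)
  moreover have "f (mult U D D') = sweedler Dual Dual (\<lambda>f1 f2. f1 D * f2 D') ?t" for D D'
    using sweedler_sum_tens[OF Dual_space Dual_space vector_space_mult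
        evaluation_bilinear[OF smul_Dual smul_Dual, of D D'], of ?N \<chi> "\<lambda>b D'. f (mult U b D')"]
      expand[of D D'] \<chi> fm by (simp add: dual_iff)
  ultimately show ?thesis unfolding carrier_tensor_algebra by blast
qed

text \<open>
  Existence and uniqueness of the tensor are what makes the definite description in the
  definition of the comultiplication meaningful.
\<close>

lemma finite_dual_comult:
  assumes "f \<in> carrier (finite_dual U)"
  shows "f (mult U D D') = sweedler Dual Dual (\<lambda>f1 f2. f1 D * f2 D') (comult (finite_dual U) f)"
proof -
  let ?P = "\<lambda>t. t \<in> tensor_space Dual Dual \<and>
      (\<forall>D D'. f (mult U D D') = sweedler Dual Dual (\<lambda>f1 f2. f1 D * f2 D') t)"
  have "\<exists>t. ?P t" using dual_tensor_exists[OF assms] by blast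
  moreover have "t = t'" if "?P t" "?P t'" for t t'
  proof (rule dual_tensor_unique)
    show "t \<in> tensor_space Dual Dual" "t' \<in> tensor_space Dual Dual" using that by blast+
    show "sweedler Dual Dual (\<lambda>f g. f D * g D') t = sweedler Dual Dual (\<lambda>f g. f D * g D') t'" for D D'
      using that by metis
  qed
  ultimately have "\<exists>!t. ?P t" by blast
  from theI'[OF this] have "?P (THE t. ?P t)" .
  moreover have "comult (finite_dual U) f = (THE t. ?P t)" unfolding finite_dual_def by simp
  ultimately show ?thesis by metis
qed

end


section \<open>The action of a Hopf subalgebra of the finite dual\<close>

lemma tens_smul_cong: "smul A = smul A' \<Longrightarrow> smul B = smul B' \<Longrightarrow> tens A B = tens A' B'"
  by (intro ext) (simp add: tens_def)

locale dual_action = total_bialgebra U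
  for U :: "('k::field, 'u::ab_group_add) hopf" +
  fixes S :: "('u \<Rightarrow> 'k) set"
  assumes hopf_subalgebra: "is_hopf_subalgebra S (finite_dual U)"
begin

abbreviation H where "H \<equiv> (finite_dual U)\<lparr>carrier := S\<rparr>"

lemma H_simps: "carrier H = S" "smul H = fscale" "mult H = mult Dual" "unity H = counit U"
    "counit H f = f (unity U)" "comult H = comult (finite_dual U)"
  by (simp_all add: finite_dual_def dual_algebra_def)

lemma H_bialgebra: "is_bialgebra H"
  using hopf_subalgebra by (simp add: is_hopf_subalgebra_def is_hopf_algebra_def)

lemmas H_space = is_algebra_carrier_space[OF conjunct1[OF H_bialgebra[unfolded is_bialgebra_def]]]

lemma H_comult_closed: "f \<in> S \<Longrightarrow> comult H f \<in> tensor_space H H"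
  using H_bialgebra by (simp add: is_bialgebra_def)

lemma S_finite_dual: "f \<in> S \<Longrightarrow> f \<in> carrier (finite_dual U)"
  using hopf_subalgebra by (auto simp: is_hopf_subalgebra_def)

lemma S_linear: "f \<in> S \<Longrightarrow> linear_on_carrier U (*) f"
  using S_finite_dual dual_iff by (simp add: finite_dual_def)

lemma H_linear: "f \<in> carrier H \<Longrightarrow> linear_on_carrier U (*) f"
  by (simp add: H_simps S_linear)

text \<open>
  A tensor over the Hopf subalgebra is also one over the dual: pure tensors depend on the ambient
  spaces only, so the same finite sum computes the Sweedler sum on both carriers.
\<close>

lemma H_comult:
  assumes "f \<in> S"
  shows "f (mult U D D') = sweedler H H (\<lambda>f1 f2. f1 D * f2 D') (comult H f)"
proof -
  have tens: "tens H H = tens Dual Dual" by (rule tens_smul_cong) (simp_all only: H_simps(2) smul_Dual)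
  obtain m :: nat and a b where ab: "\<And>i. i < m \<Longrightarrow> a i \<in> carrier H" "\<And>i. i < m \<Longrightarrow> b i \<in> carrier H"
    and t: "comult H f = (\<Sum>i<m. tens H H (a i) (b i))"
    by (rule tensor_space_rep[OF H_space H_comult_closed[OF assms]]) blast
  have "f (mult U D D') = sweedler Dual Dual (\<lambda>f1 f2. f1 D * f2 D') (comult H f)"
    unfolding H_simps(6) by (rule finite_dual_comult[OF S_finite_dual[OF assms]])
  also have "\<dots> = (\<Sum>i<m. a i D * b i D')"
    unfolding t tens using ab H_linear
    by (intro sweedler_sum_tens[OF Dual_space Dual_space vector_space_mult
          evaluation_bilinear[OF smul_Dual smul_Dual, of D D']]) (simp_all add: dual_iff)
  also have "\<dots> = sweedler H H (\<lambda>f1 f2. f1 D * f2 D') (comult H f)"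
    unfolding t using ab
    by (intro sweedler_sum_tens[OF H_space H_space vector_space_mult
          evaluation_bilinear[OF H_simps(2) H_simps(2), of D D'], symmetric]) simp_all
  finally show ?thesis .
qed

lemma act_linear_functional: "linear_on_carrier H (smul U) (\<lambda>f. act D f)"
  unfolding induced_action_def
  by (intro U_intros H_space H_simps(2) | assumption | erule H_linear)+

text \<open>
  Both sides are \<open>\<Sum> f(D\<^sub>1 D'\<^sub>1) D\<^sub>2 D'\<^sub>2\<close>: on the left because the comultiplication is
  multiplicative, on the right because \<open>f\<^sub>1 \<otimes> f\<^sub>2\<close> evaluates products.
\<close>

lemma act_mult:
  assumes f: "f \<in> S"
  shows "act (mult U D D') f = sweedler H H (\<lambda>f1 f2. mult U (act D f1) (act D' f2)) (comult H f)"
proof -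
  note lin = U_intros dual_compose[OF S_linear[OF f]] H_space H_simps(2) H_comult_closed f
  have pull: "smul U (f (mult U a a')) c
      = sweedler H H (\<lambda>f1 f2. smul U (f1 a * f2 a') c) (comult H f)" for a a' c
    unfolding H_comult[OF f]
    by (rule smul_sweedler[OF H_space H_space U_vector_space])
      (intro lin | assumption | erule H_linear)+
  have product: "mult U (act D f1) (act D' f2) = sweedler U U (\<lambda>a b. sweedler U U (\<lambda>a' b'.
        smul U (f1 a * f2 a') (mult U b b')) (comult U D')) (comult U D)"
    if g: "f1 \<in> carrier H" "f2 \<in> carrier H" for f1 f2
  proof -
    note lin = lin dual_compose[OF H_linear[OF g(1)]] dual_compose[OF H_linear[OF g(2)]]
    have "mult U (act D f1) (act D' f2)
       = sweedler U U (\<lambda>a b. mult U (smul U (f1 a) b) (act D' f2)) (comult U D)"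
      unfolding induced_action_def[of U D]
      by (rule linear_sweedler_push[where W = U and s = "smul U" and L = "\<lambda>x. mult U x (act D' f2)"])
        (intro lin | assumption)+
    also have "\<dots> = sweedler U U (\<lambda>a b. sweedler U U (\<lambda>a' b'.
        mult U (smul U (f1 a) b) (smul U (f2 a') b')) (comult U D')) (comult U D)"
      unfolding induced_action_def[of U D']
      by (intro sweedler_cong linear_sweedler_push[where W = U and s = "smul U" and L = "\<lambda>x. mult U _ x"])
        (intro lin | assumption)+
    also have "\<dots> = sweedler U U (\<lambda>a b. sweedler U U (\<lambda>a' b'.
        smul U (f1 a * f2 a') (mult U b b')) (comult U D')) (comult U D)"
      using U_vector_space by (simp add: mult_smul vector_space_def mult.commute)
    finally show ?thesis .
  qed
  have "act (mult U D D') f = sweedler U U (\<lambda>a b. sweedler U U (\<lambda>a' b'.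
      smul U (f (mult U a a')) (mult U b b')) (comult U D')) (comult U D)"
    unfolding induced_action_def
    by (rule sweedler_comult_mult[where s = "smul U"]) (intro lin | assumption)+
  also have "\<dots> = sweedler U U (\<lambda>a b. sweedler U U (\<lambda>a' b'. sweedler H H (\<lambda>f1 f2.
      smul U (f1 a * f2 a') (mult U b b')) (comult H f)) (comult U D')) (comult U D)"
    by (simp add: pull)
  also have "\<dots> = sweedler U U (\<lambda>a b. sweedler H H (\<lambda>f1 f2. sweedler U U (\<lambda>a' b'.
      smul U (f1 a * f2 a') (mult U b b')) (comult U D')) (comult H f)) (comult U D)"
    by (intro sweedler_cong sweedler_swap[where s = "smul U"]) (intro lin | assumption | erule H_linear)+
  also have "\<dots> = sweedler H H (\<lambda>f1 f2. sweedler U U (\<lambda>a b. sweedler U U (\<lambda>a' b'.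
      smul U (f1 a * f2 a') (mult U b b')) (comult U D')) (comult U D)) (comult H f)"
    by (rule sweedler_swap[where s = "smul U"]) (intro lin | assumption | erule H_linear)+
  also have "\<dots> = sweedler H H (\<lambda>f1 f2. mult U (act D f1) (act D' f2)) (comult H f)"
    by (rule sweedler_cong) (simp add: product)
  finally show ?thesis .
qed

lemma right_hopf_action: "is_right_hopf_action U H act"
proof -
  have "bilinear_on_carriers U H (smul U) act"
    using act_linear S_linear act_linear_functional
    by (auto intro!: bilinear_on_carriersI simp: H_simps(1))
  moreover have "act a (unity H) = a" for a using act_counit by (simp add: H_simps)
  moreover have "act (act a h) h' = act a (mult H h h')" if "h \<in> S" "h' \<in> S" for a h h'
    using act_act S_linear that by (simp add: H_simps)
  moreover have "act (unity U) h = smul U (counit H h) (unity U)" if "h \<in> S" for h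
    unfolding H_simps(5) by (rule act_unity_left[OF S_linear[OF that]])
  ultimately show ?thesis
    using act_mult
    by (simp add: is_right_hopf_action_def is_right_action_def H_simps(1) carrier_UNIV)
qed

lemma action_dual: "action_dual_to_mult U H act"
  using functional_act S_linear by (simp add: action_dual_to_mult_def H_simps)

lemma dual_action_unique:
  assumes "nondegenerate_pairing U H" "is_right_hopf_action U H act'" "action_dual_to_mult U H act'"
    and f: "f \<in> S"
  shows "act' D f = act D f"
proof -
  have "h (act' D f - act D f) = 0" if "h \<in> S" for h
  proof -
    have "h (act' D f) = mult H f h D" "h (act D f) = mult H f h D"
      using assms(3) action_dual f that
      unfolding action_dual_to_mult_def H_simps(1) carrier_UNIV by blast+
    then show ?thesis
      using linear_on_carrier_minus[OF U_space S_linear[OF that], of "act' D f" "act D f"]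
      by (simp add: carrier_UNIV)
  qed
  then have "act' D f - act D f = 0"
    using assms(1) unfolding nondegenerate_pairing_def H_simps(1) carrier_UNIV by blast
  then show ?thesis by simp
qed

sublocale action: hopf_action H U act
  using H_bialgebra U_algebra right_hopf_action by unfold_locales

end


section \<open>The universal enveloping algebra\<close>

locale enveloping_bialgebra = total_bialgebra U
  for U :: "('k::field, 'u::ab_group_add) hopf" +
  fixes sg :: "'k \<Rightarrow> 'g::ab_group_add \<Rightarrow> 'g" and br :: "'g \<Rightarrow> 'g \<Rightarrow> 'g" and \<iota> :: "'g \<Rightarrow> 'u"
  assumes lie: "is_lie_algebra sg br" and env: "is_enveloping_hopf_algebra sg br U \<iota>"
begin

definition monomial :: "'g list \<Rightarrow> 'u"
  where "monomial w = foldr (\<lambda>x. mult U (\<iota> x)) w (unity U)"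

text \<open>
  Each of the three families of relations consists of such combinations of three words, with
  coefficients \<open>0\<close> and \<open>1\<close> allowed.
\<close>

lemma eval_free_relation:
  "eval_free U \<iota> (word a - fscale c (word b) - fscale d (word e)) =
    monomial a - smul U c (monomial b) - smul U d (monomial e)"
proof -
  interpret V: vector_space "smul U" by (rule U_vector_space)
  let ?p = "word a - fscale c (word b) - fscale d (word e) :: 'g list \<Rightarrow> 'k"
  let ?W = "{a, b, e}"
  have delta: "(\<Sum>w\<in>?W. smul U (r * word v w) (monomial w)) = smul U r (monomial v)" if "v \<in> ?W" for r v
  proof -
    have "(\<Sum>w\<in>?W. smul U (r * word v w) (monomial w)) = (\<Sum>w\<in>?W. if w = v then smul U r (monomial w) else 0)"
      by (intro sum.cong) (auto simp: word_def)
    then show ?thesis using that by simp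
  qed
  have "eval_free U \<iota> ?p = (\<Sum>w\<in>?W. smul U (?p w) (monomial w))"
    unfolding eval_free_def monomial_def
    by (rule sum.mono_neutral_left) (auto simp: word_def fscale_def split: if_splits)
  also have "\<dots> = (\<Sum>w\<in>?W. smul U (1 * word a w) (monomial w) - smul U (c * word b w) (monomial w)
      - smul U (d * word e w) (monomial w))"
    by (intro sum.cong refl) (simp add: fscale_def V.scale_left_diff_distrib)
  also have "\<dots> = smul U 1 (monomial a) - smul U c (monomial b) - smul U d (monomial e)"
    unfolding sum_subtractf by (simp only: delta insertI1 insertI2)
  finally show ?thesis by simp
qed

lemma relation_vanishes:
  assumes "word a - fscale c (word b) - fscale d (word e) \<in> (enveloping_ideal sg br :: ('g list \<Rightarrow> 'k) set)"
  shows "monomial a = smul U c (monomial b) + smul U d (monomial e)"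
proof -
  have "eval_free U \<iota> (word a - fscale c (word b) - fscale d (word e)) = 0"
    using env assms unfolding is_enveloping_hopf_algebra_def is_universal_enveloping_def by blast
  then show ?thesis unfolding eval_free_relation by (simp add: algebra_simps)
qed

lemma fscale_simps: "fscale 1 (p :: 'x \<Rightarrow> 'k) = p" "fscale 0 (p :: 'x \<Rightarrow> 'k) = 0"
  by (simp_all add: fscale_def fun_eq_iff)

lemma monomial_simps: "monomial [] = unity U" "monomial (x # w) = mult U (\<iota> x) (monomial w)"
  by (simp_all add: monomial_def)

lemma ideal_base:
  "p \<in> {word (u @ [x + y] @ v) - word (u @ [x] @ v) - word (u @ [y] @ v) | u v x y. True} \<union>
    {word (u @ [sg c x] @ v) - fscale c (word (u @ [x] @ v)) | u v c x. True} \<union>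
    {word (u @ [x, y] @ v) - word (u @ [y, x] @ v) - word (u @ [br x y] @ v) | u v x y. True} \<Longrightarrow>
    p \<in> (enveloping_ideal sg br :: ('g list \<Rightarrow> 'k) set)"
  unfolding enveloping_ideal_def
  by (rule module.span_base) (simp_all add: module_iff_vector_space vector_space_fscale)

lemma iota_add: "\<iota> (x + y) = \<iota> x + \<iota> y"
proof -
  interpret V: vector_space "smul U" by (rule U_vector_space)
  have "word [x + y] - word [x] - word [y] \<in> (enveloping_ideal sg br :: ('g list \<Rightarrow> 'k) set)"
    by (intro ideal_base UnI1 CollectI exI[of _ "[]"] exI[of _ x] exI[of _ y]) simp
  then have "word [x + y] - fscale 1 (word [x]) - fscale 1 (word [y]) \<in> (enveloping_ideal sg br :: ('g list \<Rightarrow> 'k) set)"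
    unfolding fscale_simps .
  from relation_vanishes[OF this] show ?thesis by (simp add: monomial_simps mult_unity)
qed

lemma iota_scale: "\<iota> (sg c x) = smul U c (\<iota> x)"
proof -
  interpret V: vector_space "smul U" by (rule U_vector_space)
  have "word [sg c x] - fscale c (word [x]) \<in> (enveloping_ideal sg br :: ('g list \<Rightarrow> 'k) set)"
    by (intro ideal_base UnI1 UnI2 CollectI exI[of _ "[]"] exI[of _ c] exI[of _ x]) simp
  then have "word [sg c x] - fscale c (word [x]) - fscale 0 (word [x]) \<in> (enveloping_ideal sg br :: ('g list \<Rightarrow> 'k) set)"
    unfolding fscale_simps by simp
  from relation_vanishes[OF this] show ?thesis by (simp add: monomial_simps mult_unity)
qed

lemma iota_bracket: "mult U (\<iota> x) (\<iota> y) = mult U (\<iota> y) (\<iota> x) + \<iota> (br x y)"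
proof -
  interpret V: vector_space "smul U" by (rule U_vector_space)
  have "word [x, y] - word [y, x] - word [br x y] \<in> (enveloping_ideal sg br :: ('g list \<Rightarrow> 'k) set)"
    by (intro ideal_base UnI2 CollectI exI[of _ "[]"] exI[of _ x] exI[of _ y]) simp
  then have "word [x, y] - fscale 1 (word [y, x]) - fscale 1 (word [br x y]) \<in> (enveloping_ideal sg br :: ('g list \<Rightarrow> 'k) set)"
    unfolding fscale_simps .
  from relation_vanishes[OF this] show ?thesis by (simp add: monomial_simps mult_unity)
qed

lemma iota_0: "\<iota> 0 = 0"
  using iota_add[of 0 0] by simp

lemma iota_sum: "\<iota> (\<Sum>i\<in>I. f i) = (\<Sum>i\<in>I. \<iota> (f i))"
  by (induction I rule: infinite_finite_induct) (simp_all add: iota_add iota_0)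

text \<open>
  The linear combinations of monomials exhaust \<open>U\<close>, and by linearity of \<open>\<iota>\<close> a subspace stable under
  left multiplication by the basis is stable under that by the whole Lie algebra.
\<close>

lemma enveloping_left_generates:
  assumes basis: "is_basis sg n X"
  shows "left_generates U ((\<lambda>i. \<iota> (X i)) ` {1..n})"
  unfolding left_generates_def
proof (intro conjI allI impI; (elim conjE)?)
  show "(\<lambda>i. \<iota> (X i)) ` {1..n} \<subseteq> carrier U" by (simp add: carrier_UNIV)
  fix V assume V: "module.subspace (smul U) V" and one: "unity U \<in> V"
    and gen: "\<forall>x\<in>(\<lambda>i. \<iota> (X i)) ` {1..n}. \<forall>D\<in>V. mult U x D \<in> V"
  interpret V: vector_space "smul U" by (rule U_vector_space)
  interpret G: vector_space sg using lie by (simp add: is_lie_algebra_def)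
  have m0: "mult U 0 D = 0" for D using mult_sum(1)[of _ "{}"] by simp
  have "G.subspace {x. \<forall>D\<in>V. mult U (\<iota> x) D \<in> V}"
    using V by (intro G.subspaceI)
      (auto simp: iota_0 iota_add iota_scale m0 mult_add mult_smul V.subspace_0 V.subspace_add V.subspace_scale)
  moreover have "X ` {1..n} \<subseteq> {x. \<forall>D\<in>V. mult U (\<iota> x) D \<in> V}" using gen by auto
  ultimately have "G.span (X ` {1..n}) \<subseteq> {x. \<forall>D\<in>V. mult U (\<iota> x) D \<in> V}"
    by (intro G.span_minimal)
  then have all: "mult U (\<iota> x) D \<in> V" if "D \<in> V" for x D
    using basis that by (auto simp: is_basis_def)
  have mono: "monomial w \<in> V" for w
    by (induction w) (simp_all add: monomial_simps one all)
  have "eval_free U \<iota> p \<in> V" for p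
    unfolding eval_free_def monomial_def[symmetric]
    by (intro V.subspace_sum V.subspace_scale V mono)
  then have "eval_free U \<iota> ` free_algebra \<subseteq> V" by blast
  then show "carrier U \<subseteq> V"
    using env unfolding is_enveloping_hopf_algebra_def is_universal_enveloping_def by metis
qed

lemma comult_iota: "comult U (\<iota> x) = tens U U (\<iota> x) (unity U) + tens U U (unity U) (\<iota> x)"
  using env by (simp add: is_enveloping_hopf_algebra_def)

lemma sweedler_comult_iota:
  assumes s: "vector_space s" and \<phi>: "bilinear_on_carriers U U s \<phi>"
  shows "sweedler U U \<phi> (comult U (\<iota> x)) = \<phi> (\<iota> x) (unity U) + \<phi> (unity U) (\<iota> x)"
  using linear_on_carrier_add[OF linear_sweedler[OF U_space U_space s \<phi>],
      of "tens U U (\<iota> x) (unity U)" "tens U U (unity U) (\<iota> x)"]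
  by (simp add: comult_iota carrier_tensor_algebra tens_in_tensor_space mem_carrier
      sweedler_tens[OF U_space U_space s \<phi>])

lemma counit_iota: "counit U (\<iota> x) = 0"
proof -
  interpret V: vector_space "smul U" by (rule U_vector_space)
  have bil: "bilinear_on_carriers U U (smul U) (\<lambda>a b. smul U (counit U a) b)"
    by (intro U_intros dual_compose[OF counit_linear] | assumption)+
  have "smul U (counit U (\<iota> x)) (unity U) + \<iota> x = \<iota> x"
    using comult_counit[of "\<iota> x"] sweedler_comult_iota[OF U_vector_space bil, of x]
    by (simp add: counit_unity)
  then have "smul U (counit U (\<iota> x)) (unity U) = 0" by (metis add_cancel_left_left)
  then have "counit U (smul U (counit U (\<iota> x)) (unity U)) = counit U 0" by (rule arg_cong)
  then show ?thesis
    using linear_on_carrier_0[OF U_space counit_linear]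
    by (simp add: linear_on_carrier_smul[OF counit_linear] mem_carrier counit_unity)
qed

lemma antipode_iota: "antipode U (\<iota> x) = - \<iota> x"
proof -
  interpret V: vector_space "smul U" by (rule U_vector_space)
  have H: "is_hopf_algebra U" using env by (simp add: is_enveloping_hopf_algebra_def)
  have S: "linear_on_carrier U (smul U) (antipode U)"
    and law: "sweedler U U (\<lambda>a b. mult U (antipode U a) b) (comult U D) = smul U (counit U D) (unity U)" for D
    using H by (simp_all add: is_hopf_algebra_def mem_carrier)
  have bil: "bilinear_on_carriers U U (smul U) (\<lambda>a b. mult U (antipode U a) b)"
    by (intro U_intros S | assumption)+
  have "antipode U (unity U) = unity U"
    using law[of "unity U"] sweedler_tens[OF U_space U_space U_vector_space bil, of "unity U" "unity U"]
    by (simp add: comult_unity mem_carrier mult_unity counit_unity)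
  then have "antipode U (\<iota> x) + \<iota> x = 0"
    using law[of "\<iota> x"] sweedler_comult_iota[OF U_vector_space bil, of x]
    by (simp add: mult_unity counit_iota)
  then show ?thesis by (simp add: eq_neg_iff_add_eq_0)
qed

text \<open>
  Leibniz' rule, with \<open>D \<triangleleft> f(x \<cdot>)\<close> as its first term: \<open>x\<close> is primitive, so in
  \<open>\<Delta>(x D) = (x \<otimes> 1 + 1 \<otimes> x) \<Delta>(D)\<close> it enters either the argument of \<open>f\<close> or the remaining factor.
\<close>

lemma act_iota_mult:
  assumes f: "linear_on_carrier U (*) f"
  shows "act (mult U (\<iota> x) D) f = act D (\<lambda>y. f (mult U (\<iota> x) y)) + mult U (\<iota> x) (act D f)"
proof -
  note lin = U_intros dual_compose[OF f]
  let ?\<psi> = "\<lambda>a b. sweedler U U (\<lambda>a' b'. smul U (f (mult U a a')) (mult U b b')) (comult U D)"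
  have "act (mult U (\<iota> x) D) f = sweedler U U ?\<psi> (comult U (\<iota> x))"
    unfolding induced_action_def
    by (rule sweedler_comult_mult[where s = "smul U"]) (intro lin | assumption)+
  also have "\<dots> = ?\<psi> (\<iota> x) (unity U) + ?\<psi> (unity U) (\<iota> x)"
    by (rule sweedler_comult_iota[where s = "smul U"]) (intro lin | assumption)+
  also have "?\<psi> (\<iota> x) (unity U) = act D (\<lambda>y. f (mult U (\<iota> x) y))"
    by (simp add: induced_action_def mult_unity)
  also have "?\<psi> (unity U) (\<iota> x) = sweedler U U (\<lambda>a b. mult U (\<iota> x) (smul U (f a) b)) (comult U D)"
    by (simp add: mult_unity mult_smul)
  also have "\<dots> = mult U (\<iota> x) (act D f)"
    unfolding induced_action_def
    by (rule linear_sweedler_push[where W = U and s = "smul U" and L = "mult U (\<iota> x)", symmetric])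
      (intro lin | assumption)+
  finally show ?thesis .
qed

lemma act_iota:
  assumes f: "linear_on_carrier U (*) f"
  shows "act (\<iota> x) f = smul U (f (\<iota> x)) (unity U) + smul U (f (unity U)) (\<iota> x)"
proof -
  have fx: "linear_on_carrier U (*) (\<lambda>y. f (mult U (\<iota> x) y))"
    by (intro U_intros dual_compose[OF f])
  show ?thesis
    using act_iota_mult[OF f, of x "unity U"] act_unity_left[OF f] act_unity_left[OF fx]
    by (simp add: mult_unity mult_smul)
qed

text \<open>
  By Leibniz' rule, if \<open>\<Sum> (D \<triangleleft> f\<^sub>e) g\<^sub>e\<close> vanishes for all \<open>D\<close>, then it still does after
  replacing the functionals \<open>f\<^sub>e\<close> by their translates \<open>f\<^sub>e(x \<cdot>)\<close> with \<open>x \<in> \<gg>\<close>. At \<open>D = 1\<close> the sum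
  is \<open>\<Sum> f\<^sub>e(1) g\<^sub>e\<close>, and repeated translation replaces \<open>1\<close> by any monomial. The induction therefore
  runs over statements about all families \<open>f\<close>.
\<close>

lemma act_combination_vanishes:
  assumes basis: "is_basis sg n X"
    and f: "\<And>e. e \<in> E \<Longrightarrow> linear_on_carrier U (*) (f e)"
    and zero: "\<And>D. (\<Sum>e\<in>E. mult U (act D (f e)) (g e)) = 0"
  shows "(\<Sum>e\<in>E. smul U (f e D) (g e)) = 0"
proof -
  interpret V: vector_space "smul U" by (rule U_vector_space)
  define P where "P = (\<lambda>D. \<forall>f. (\<forall>e\<in>E. linear_on_carrier U (*) (f e)) \<longrightarrow>
    (\<forall>D. (\<Sum>e\<in>E. mult U (act D (f e)) (g e)) = 0) \<longrightarrow> (\<Sum>e\<in>E. smul U (f e D) (g e)) = 0)"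
  have "P D"
  proof (rule left_generates_induct[OF enveloping_left_generates[OF basis] U_space mem_carrier])
    show "P (unity U)"
      unfolding P_def
    proof (intro allI impI)
      fix f assume "\<forall>e\<in>E. linear_on_carrier U (*) (f e)"
        and "\<forall>D. (\<Sum>e\<in>E. mult U (act D (f e)) (g e)) = 0"
      moreover from this have "(\<Sum>e\<in>E. smul U (f e (unity U)) (g e)) =
          (\<Sum>e\<in>E. mult U (act (unity U) (f e)) (g e))"
        by (intro sum.cong) (simp_all add: act_unity_left mult_smul mult_unity)
      ultimately show "(\<Sum>e\<in>E. smul U (f e (unity U)) (g e)) = 0" by simp
    qed
    show "P (x + y)" if "P x" "P y" for x y
      unfolding P_def
    proof (intro allI impI)
      fix f assume *: "\<forall>e\<in>E. linear_on_carrier U (*) (f e)"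
        "\<forall>D. (\<Sum>e\<in>E. mult U (act D (f e)) (g e)) = 0"
      have "(\<Sum>e\<in>E. smul U (f e (x + y)) (g e)) = (\<Sum>e\<in>E. smul U (f e x) (g e) + smul U (f e y) (g e))"
        using * by (intro sum.cong) (simp_all add: linear_on_carrier_def mem_carrier V.scale_left_distrib)
      then show "(\<Sum>e\<in>E. smul U (f e (x + y)) (g e)) = 0"
        using that * unfolding P_def sum.distrib by simp
    qed
    show "P (smul U c x)" if "P x" for c x
      unfolding P_def
    proof (intro allI impI)
      fix f assume *: "\<forall>e\<in>E. linear_on_carrier U (*) (f e)"
        "\<forall>D. (\<Sum>e\<in>E. mult U (act D (f e)) (g e)) = 0"
      have "(\<Sum>e\<in>E. smul U (f e (smul U c x)) (g e)) = (\<Sum>e\<in>E. smul U c (smul U (f e x) (g e)))"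
        using * by (intro sum.cong) (simp_all add: linear_on_carrier_def mem_carrier)
      then show "(\<Sum>e\<in>E. smul U (f e (smul U c x)) (g e)) = 0"
        using that * unfolding P_def V.scale_sum_right[symmetric] by simp
    qed
    show "P (mult U x D)" if x: "x \<in> (\<lambda>i. \<iota> (X i)) ` {1..n}" and PD: "P D" for x D
      unfolding P_def
    proof (intro allI impI)
      fix f assume *: "\<forall>e\<in>E. linear_on_carrier U (*) (f e)"
        "\<forall>D. (\<Sum>e\<in>E. mult U (act D (f e)) (g e)) = 0"
      obtain y where y: "x = \<iota> y" using x by auto
      let ?f = "\<lambda>e D. f e (mult U (\<iota> y) D)"
      have f_lin: "linear_on_carrier U (*) (?f e)" if "e \<in> E" for e
      proof -
        have "linear_on_carrier U (*) (f e)" using that * by blast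
        then show ?thesis by (rule dual_compose) (intro U_intros)
      qed
      have f_zero: "(\<Sum>e\<in>E. mult U (act D (?f e)) (g e)) = 0" for D
      proof -
        have "(\<Sum>e\<in>E. mult U (act (mult U (\<iota> y) D) (f e)) (g e)) =
            (\<Sum>e\<in>E. mult U (act D (?f e)) (g e) + mult U (\<iota> y) (mult U (act D (f e)) (g e)))"
          using * by (intro sum.cong) (simp_all add: act_iota_mult mult_add mult_assoc)
        also have "\<dots> = (\<Sum>e\<in>E. mult U (act D (?f e)) (g e)) + mult U (\<iota> y) (\<Sum>e\<in>E. mult U (act D (f e)) (g e))"
          by (simp add: sum.distrib mult_sum(2))
        finally show ?thesis using * mult_sum(2)[of _ _ "{}"] by simp
      qed
      show "(\<Sum>e\<in>E. smul U (f e (mult U x D)) (g e)) = 0"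
        unfolding y by (rule PD[unfolded P_def, rule_format, of ?f]) (fact f_lin, fact f_zero)
    qed
  qed (simp_all add: mem_carrier)
  then show ?thesis using f zero unfolding P_def by blast
qed

end


section \<open>The action on the enveloping algebra\<close>

locale enveloping_dual_action = dual_action U S + enveloping_bialgebra U sg br \<iota>
  for U :: "('k::field, 'u::ab_group_add) hopf" and S
    and sg :: "'k \<Rightarrow> 'g::ab_group_add \<Rightarrow> 'g" and br \<iota> +
  fixes n :: nat and X :: "nat \<Rightarrow> 'g" and C :: "nat \<Rightarrow> nat \<Rightarrow> nat \<Rightarrow> 'k"
    and Um Ub :: "nat \<Rightarrow> nat \<Rightarrow> 'u \<Rightarrow> 'k"
  assumes basis: "is_basis sg n X"
    and struct: "structure_constants sg br n X C"
    and adj: "adjoint_functionals U \<iota> n X C Um Ub"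
    and min: "enveloping_min U n Um Ub \<subseteq> S"
begin

text \<open>
  Write \<open>t = \<Sum> e \<otimes> g\<^sub>e\<close> with independent functionals \<open>e\<close>. If the operator of \<open>t\<close> is zero, then
  \<open>\<Sum> e(D) g\<^sub>e = 0\<close> for all \<open>D\<close> by the preceding lemma. A functional \<open>\<psi>\<close> turns this into
  the relation \<open>\<Sum> \<psi>(g\<^sub>e) e = 0\<close>, so no \<open>\<psi>\<close> separates \<open>g\<^sub>e\<close> from zero.
\<close>

lemma operator_faithful:
  assumes t: "t \<in> tensor_space H U" and zero: "\<And>D. D \<in> carrier U \<Longrightarrow> action.operator t D = 0"
  shows "t = 0"
proof -
  interpret F: vector_space "fscale :: 'k \<Rightarrow> ('u \<Rightarrow> 'k) \<Rightarrow> _" by (rule vector_space_fscale)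
  obtain E g where E: "finite E" "E \<subseteq> carrier H" "\<not> module.dependent (smul H) E"
    and g: "\<And>e. e \<in> E \<Longrightarrow> g e \<in> carrier U"
    and rep: "t = (\<Sum>e\<in>E. tens H U e (g e))"
    by (rule tensor_space_rep_independent[OF H_space U_space t]) blast
  have zero': "(\<Sum>e\<in>E. mult U (act D e) (g e)) = 0" for D
  proof -
    have "(\<Sum>e\<in>E. mult U (act D e) (g e)) = (\<Sum>e\<in>E. action.operator (tens H U e (g e)) D)"
      using E(2) by (intro sum.cong) (auto simp only: action.operator_tens mem_carrier)
    also have "\<dots> = action.operator t D"
      unfolding rep using E(2)
      by (intro linear_on_carrier_sum[OF carrier_space_tensor action.operator_linear, symmetric] mem_carrier)
        (auto simp only: carrier_tensor_algebra intro!: tens_in_tensor_space mem_carrier)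
    also have "\<dots> = 0" by (rule zero[OF mem_carrier])
    finally show ?thesis .
  qed
  have vanish: "(\<Sum>e\<in>E. smul U (e D) (g e)) = 0" for D
    using act_combination_vanishes[OF basis, of E "\<lambda>e. e" g D] zero' E(2) H_linear by blast
  have "g e = 0" if e: "e \<in> E" for e
  proof (rule ccontr)
    assume "g e \<noteq> 0"
    then obtain \<psi> where \<psi>: "Vector_Spaces.linear (smul U) (*) \<psi>" "\<psi> (g e) \<noteq> (0::'k)"
      using separating_functional[OF U_vector_space] by metis
    have \<psi>l: "linear_on_carrier U (*) \<psi>" using dual_iff[of \<psi>] \<psi>(1) by (simp add: dual_algebra_def)
    have "(\<Sum>e\<in>E. fscale (\<psi> (g e)) e) D = 0" for D
    proof -
      have "(\<Sum>e\<in>E. fscale (\<psi> (g e)) e) D = (\<Sum>e\<in>E. \<psi> (smul U (e D) (g e)))"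
        using \<psi>l by (simp add: sum_functionals fscale_def linear_on_carrier_def mem_carrier mult.commute)
      also have "\<dots> = \<psi> (\<Sum>e\<in>E. smul U (e D) (g e))"
        by (rule linear_on_carrier_sum[OF U_space \<psi>l mem_carrier, symmetric])
      also have "\<dots> = 0" unfolding vanish by (rule linear_on_carrier_0[OF U_space \<psi>l])
      finally show ?thesis .
    qed
    then have "(\<Sum>e\<in>E. fscale (\<psi> (g e)) e) = 0" by (simp add: fun_eq_iff)
    then show False
      using F.independentD[OF E(3)[unfolded H_simps(2)] E(1) order.refl, of "\<lambda>e. \<psi> (g e)" e] e \<psi>(2) by simp
  qed
  then show ?thesis unfolding rep by (simp add: tens_zero_right)
qed

sublocale faithful: faithful_hopf_action H U act
  by unfold_locales (rule operator_faithful)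

lemma Ub_in_S: "i \<in> {1..n} \<Longrightarrow> j \<in> {1..n} \<Longrightarrow> Ub i j \<in> S"
  using min unfolding enveloping_min_def generated_subalgebra_def by blast

lemma Ub_unity:
  assumes "i \<in> {1..n}" "j \<in> {1..n}"
  shows "Ub i j (unity U) = (if i = j then 1 else 0)"
proof -
  have "counit (finite_dual U) (Ub i j) = (if i = j then 1 else 0)"
    using adj assms unfolding adjoint_functionals_def Let_def by blast
  then show ?thesis by (simp add: finite_dual_def)
qed

lemma Ub_iota:
  assumes i: "i \<in> {1..n}" and j: "j \<in> {1..n}" and k: "k \<in> {1..n}"
  shows "Ub i j (\<iota> (X k)) = - C k j i"
proof -
  have "antipode (finite_dual U) (Um i j) = Ub i j" "Um i j \<in> carrier (finite_dual U)"
    and U: "Um i j (\<iota> (X k)) = C k j i"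
    using adj i j k unfolding adjoint_functionals_def Let_def by blast+
  then have "Ub i j = (\<lambda>D. Um i j (antipode U D))" and lin: "linear_on_carrier U (*) (Um i j)"
    using dual_iff by (auto simp: finite_dual_def)
  then have "Ub i j (\<iota> (X k)) = Um i j (0 - \<iota> (X k))" by (simp add: antipode_iota)
  also have "\<dots> = - C k j i"
    using linear_on_carrier_minus[OF U_space lin, of 0 "\<iota> (X k)"] linear_on_carrier_0[OF U_space lin] U
    by (simp add: mem_carrier)
  finally show ?thesis .
qed

lemma act_mult_Ub:
  assumes i: "i \<in> {1..n}" and j: "j \<in> {1..n}"
  shows "act (mult U D D') (Ub i j) = (\<Sum>l=1..n. mult U (act D (Ub l j)) (act D' (Ub i l)))"
proof -
  have "tens (finite_dual U) (finite_dual U) = tens H H" by (rule tens_smul_cong) simp_all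
  moreover have "comult (finite_dual U) (Ub i j) = (\<Sum>k=1..n. tens (finite_dual U) (finite_dual U) (Ub k j) (Ub i k))"
    using adj i j unfolding adjoint_functionals_def Let_def by blast
  ultimately have c: "comult H (Ub i j) = (\<Sum>l=1..n. tens H H (Ub l j) (Ub i l))"
    unfolding H_simps(6) by simp
  have bil: "bilinear_on_carriers H H (smul U) (\<lambda>f1 f2. mult U (act D f1) (act D' f2))"
    by (intro action.operator_intros mem_carrier | assumption)+
  show ?thesis
    unfolding act_mult[OF Ub_in_S[OF i j]] c using i j
    by (intro sweedler_sum_tens[OF H_space H_space U_vector_space bil])
      (simp_all only: H_simps(1) Ub_in_S)
qed

text \<open>
  The prescribed value \<open>\<lambda>(X\<^sub>j)\<close> has left multiplication by \<open>X\<^sub>j\<close> as its operator. By induction along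
  left multiplication by \<open>X\<^sub>k\<close>: the comultiplication of the barred functionals reduces the value at
  \<open>X\<^sub>k D\<close> to that at \<open>D\<close> and to the value at \<open>X\<^sub>k\<close>, which is \<open>X\<^sub>k X\<^sub>j - [X\<^sub>k, X\<^sub>j] = X\<^sub>j X\<^sub>k\<close>.
\<close>

lemma act_Ub_iota:
  assumes j: "j \<in> {1..n}"
  shows "(\<Sum>i=1..n. mult U (act D (Ub i j)) (\<iota> (X i))) = mult U (\<iota> (X j)) D"
proof -
  interpret V: vector_space "smul U" by (rule U_vector_space)
  define P where "P = (\<lambda>D. \<forall>j\<in>{1..n}. (\<Sum>i=1..n. mult U (act D (Ub i j)) (\<iota> (X i))) = mult U (\<iota> (X j)) D)"
  have lin: "linear_on_carrier U (*) (Ub i j)" if "i \<in> {1..n}" "j \<in> {1..n}" for i j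
    using S_linear[OF Ub_in_S[OF that]] .
  have m0: "mult U 0 D = 0" for D using mult_sum(1)[of _ "{}"] by simp
  have "P D"
  proof (rule left_generates_induct[OF enveloping_left_generates[OF basis] U_space mem_carrier])
    show "P (unity U)"
      unfolding P_def
    proof
      fix j assume j: "j \<in> {1..n}"
      have "(\<Sum>i=1..n. mult U (act (unity U) (Ub i j)) (\<iota> (X i))) = (\<Sum>i=1..n. if i = j then \<iota> (X i) else 0)"
        using j by (intro sum.cong) (auto simp: act_unity_left lin Ub_unity mult_smul mult_unity)
      then show "(\<Sum>i=1..n. mult U (act (unity U) (Ub i j)) (\<iota> (X i))) = mult U (\<iota> (X j)) (unity U)"
        using j by (simp add: mult_unity)
    qed
    show "P (x + y)" if "P x" "P y" for x y
      unfolding P_def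
    proof
      fix j assume j: "j \<in> {1..n}"
      have "(\<Sum>i=1..n. mult U (act (x + y) (Ub i j)) (\<iota> (X i))) =
          (\<Sum>i=1..n. mult U (act x (Ub i j)) (\<iota> (X i)) + mult U (act y (Ub i j)) (\<iota> (X i)))"
        using j linear_on_carrier_add[OF act_linear[OF lin]]
        by (intro sum.cong) (simp_all add: mem_carrier mult_add)
      then show "(\<Sum>i=1..n. mult U (act (x + y) (Ub i j)) (\<iota> (X i))) = mult U (\<iota> (X j)) (x + y)"
        using that j unfolding P_def by (simp add: sum.distrib mult_add)
    qed
    show "P (smul U c x)" if "P x" for c x
      unfolding P_def
    proof
      fix j assume j: "j \<in> {1..n}"
      have "(\<Sum>i=1..n. mult U (act (smul U c x) (Ub i j)) (\<iota> (X i))) =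
          (\<Sum>i=1..n. smul U c (mult U (act x (Ub i j)) (\<iota> (X i))))"
        using j linear_on_carrier_smul[OF act_linear[OF lin]]
        by (intro sum.cong) (simp_all add: mem_carrier mult_smul)
      then show "(\<Sum>i=1..n. mult U (act (smul U c x) (Ub i j)) (\<iota> (X i))) = mult U (\<iota> (X j)) (smul U c x)"
        using that j unfolding P_def V.scale_sum_right[symmetric] by (simp add: mult_smul)
    qed
    show "P (mult U x D)" if x: "x \<in> (\<lambda>i. \<iota> (X i)) ` {1..n}" and PD: "P D" for x D
      unfolding P_def
    proof
      fix j assume j: "j \<in> {1..n}"
      obtain k where k: "k \<in> {1..n}" "x = \<iota> (X k)" using x by blast
      have act_x: "act x (Ub l j) = smul U (- C k j l) (unity U) + (if l = j then x else 0)"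
        if "l \<in> {1..n}" for l
        unfolding k(2) act_iota[OF lin[OF that j]] Ub_unity[OF that j] Ub_iota[OF that j k(1)] by simp
      have bracket: "\<iota> (br (X k) (X j)) = (\<Sum>l=1..n. smul U (C k j l) (\<iota> (X l)))"
        using struct k(1) j by (simp add: structure_constants_def iota_sum iota_scale)
      have "(\<Sum>i=1..n. mult U (act (mult U x D) (Ub i j)) (\<iota> (X i))) =
          (\<Sum>i=1..n. \<Sum>l=1..n. mult U (act x (Ub l j)) (mult U (act D (Ub i l)) (\<iota> (X i))))"
        using j by (intro sum.cong) (simp_all only: act_mult_Ub mult_sum mult_assoc)
      also have "\<dots> = (\<Sum>l=1..n. mult U (act x (Ub l j)) (\<Sum>i=1..n. mult U (act D (Ub i l)) (\<iota> (X i))))"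
        unfolding mult_sum by (rule sum.swap)
      also have "\<dots> = (\<Sum>l=1..n. mult U (act x (Ub l j)) (mult U (\<iota> (X l)) D))"
        using PD by (intro sum.cong) (simp_all add: P_def)
      also have "\<dots> = (\<Sum>l=1..n. mult U (mult U (act x (Ub l j)) (\<iota> (X l))) D)"
        by (simp add: mult_assoc)
      also have "\<dots> = mult U (\<Sum>l=1..n. mult U (act x (Ub l j)) (\<iota> (X l))) D"
        by (simp add: mult_sum)
      also have "(\<Sum>l=1..n. mult U (act x (Ub l j)) (\<iota> (X l))) =
          (\<Sum>l=1..n. (if l = j then mult U x (\<iota> (X l)) else 0) - smul U (C k j l) (\<iota> (X l)))"
      proof (intro sum.cong refl)
        fix l assume l: "l \<in> {1..n}"
        show "mult U (act x (Ub l j)) (\<iota> (X l)) =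
            (if l = j then mult U x (\<iota> (X l)) else 0) - smul U (C k j l) (\<iota> (X l))"
          unfolding act_x[OF l] mult_add(1) mult_smul(1) mult_unity(1) by (simp add: m0)
      qed
      also have "\<dots> = mult U x (\<iota> (X j)) - \<iota> (br (X k) (X j))"
        using j by (simp add: sum_subtractf bracket)
      also have "\<dots> = mult U (\<iota> (X j)) x"
        unfolding k(2) iota_bracket[of "X k" "X j"] by simp
      finally show "(\<Sum>i=1..n. mult U (act (mult U x D) (Ub i j)) (\<iota> (X i))) = mult U (\<iota> (X j)) (mult U x D)"
        by (simp add: mult_assoc)
    qed
  qed (simp_all add: mem_carrier)
  then show ?thesis using j by (simp add: P_def)
qed

definition coaction_generator :: "nat \<Rightarrow> ('k, 'u \<Rightarrow> 'k, 'u) tensor"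
  where "coaction_generator j = (\<Sum>i=1..n. tens H U (Ub i j) (\<iota> (X i)))"

lemma coaction_generator_closed:
  assumes "j \<in> {1..n}"
  shows "coaction_generator j \<in> tensor_space H U"
proof -
  have "coaction_generator j \<in> carrier (tensor_algebra H U)"
    unfolding coaction_generator_def using assms
    by (intro carrier_space_sum[OF carrier_space_tensor])
      (simp only: carrier_tensor_algebra tens_in_tensor_space mem_carrier H_simps(1) Ub_in_S)
  then show ?thesis by (simp only: carrier_tensor_algebra)
qed

lemma operator_coaction_generator:
  assumes "j \<in> {1..n}"
  shows "action.operator (coaction_generator j) D = mult U (\<iota> (X j)) D"
proof -
  have bil: "bilinear_on_carriers H U (smul U) (\<lambda>h a. mult U (act D h) a)"
    by (intro action.operator_intros mem_carrier | assumption)+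
  have "action.operator (coaction_generator j) D = (\<Sum>i=1..n. mult U (act D (Ub i j)) (\<iota> (X i)))"
    unfolding action.operator_def coaction_generator_def using assms
    by (intro sweedler_sum_tens[OF H_space U_space U_vector_space bil])
      (simp_all only: H_simps(1) mem_carrier Ub_in_S)
  then show ?thesis by (simp only: act_Ub_iota[OF assms])
qed

definition is_lambda :: "('u \<Rightarrow> ('k, 'u \<Rightarrow> 'k, 'u) tensor) \<Rightarrow> bool"
  where "is_lambda lam \<longleftrightarrow> is_unital_antihom U (smash_product H U act) lam \<and>
    (\<forall>j\<in>{1..n}. lam (\<iota> (X j)) = coaction_generator j)"

lemma lambda_regular_coaction:
  assumes "is_lambda lam"
  shows "regular_coaction H U act lam"
proof (rule faithful.regular_coactionI)
  show "lam a \<in> tensor_space H U" for a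
    using assms unfolding is_lambda_def is_unital_antihom_def action.smash_product_simps
    by (simp only: mem_carrier)
  show "action.operator (lam a) D = mult U a D" for a D
  proof -
    have "\<forall>D\<in>carrier U. action.operator (lam a) D = mult U a D"
      using assms operator_coaction_generator
      by (intro faithful.antihom_operator[OF enveloping_left_generates[OF basis]])
        (auto simp only: is_lambda_def mem_carrier)
    then show ?thesis using mem_carrier by blast
  qed
qed

lemma lambda_exists: "\<exists>lam. is_lambda lam"
proof -
  define P where "P = (\<lambda>a t. t \<in> tensor_space H U \<and> (\<forall>D. action.operator t D = mult U a D))"
  have "\<exists>t\<in>tensor_space H U. \<forall>D\<in>carrier U. action.operator t D = mult U a D" for a
  proof (rule faithful.left_multiplication_represented[OF enveloping_left_generates[OF basis] _ mem_carrier])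
    fix x assume "x \<in> (\<lambda>i. \<iota> (X i)) ` {1..n}"
    then obtain j where j: "j \<in> {1..n}" "x = \<iota> (X j)" by (rule imageE)
    show "\<exists>t\<in>tensor_space H U. \<forall>D\<in>carrier U. action.operator t D = mult U x D"
      unfolding j(2)
      by (rule bexI[OF _ coaction_generator_closed[OF j(1)]])
        (rule ballI, rule operator_coaction_generator[OF j(1)])
  qed
  then have ex: "\<exists>t. P a t" for a unfolding P_def using mem_carrier by blast
  define lam where "lam = (\<lambda>a. SOME t. P a t)"
  have "P a (lam a)" for a unfolding lam_def by (rule someI_ex[OF ex])
  then have lam: "lam a \<in> tensor_space H U" "action.operator (lam a) D = mult U a D" for a D
    unfolding P_def by blast+
  interpret R: regular_coaction H U act lam by (rule faithful.regular_coactionI) (rule lam)+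
  have "lam (\<iota> (X j)) = coaction_generator j" if "j \<in> {1..n}" for j
    by (rule faithful.operator_inject)
      (simp_all only: lam coaction_generator_closed operator_coaction_generator that)
  then show ?thesis using R.lam_antihom unfolding is_lambda_def by blast
qed

lemma lambda_unique:
  assumes "is_lambda lam" "is_lambda lam'"
  shows "lam = lam'"
proof
  fix a
  interpret R: regular_coaction H U act lam by (rule lambda_regular_coaction[OF assms(1)])
  interpret R': regular_coaction H U act lam' by (rule lambda_regular_coaction[OF assms(2)])
  show "lam a = lam' a"
    by (rule faithful.operator_inject)
      (simp_all only: R.lam_closed R'.lam_closed R.operator_lam R'.operator_lam mem_carrier)
qed

end

theorem theorem5p5:
  fixes sg :: "'k::field \<Rightarrow> 'g::ab_group_add \<Rightarrow> 'g"
    and br :: "'g \<Rightarrow> 'g \<Rightarrow> 'g"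
    and n :: nat
    and X :: "nat \<Rightarrow> 'g"
    and C :: "nat \<Rightarrow> nat \<Rightarrow> nat \<Rightarrow> 'k"
    and U :: "('k, 'u::ab_group_add) hopf"
    and \<iota> :: "'g \<Rightarrow> 'u"
    and Um Ub :: "nat \<Rightarrow> nat \<Rightarrow> 'u \<Rightarrow> 'k"
    and S :: "('u \<Rightarrow> 'k) set"
  assumes lie: "is_lie_algebra sg br"
    and basis: "is_basis sg n X"
    and struct: "structure_constants sg br n X C"
    and env: "is_enveloping_hopf_algebra sg br U \<iota>"
    and adj: "adjoint_functionals U \<iota> n X C Um Ub"
    and hopf: "is_hopf_subalgebra S (finite_dual U)"
    and min: "enveloping_min U n Um Ub \<subseteq> S"
  shows "let H = (finite_dual U)\<lparr>carrier := S\<rparr>; act = induced_action U in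
    is_right_hopf_action U H act \<and>
    action_dual_to_mult U H act \<and>
    (nondegenerate_pairing U H \<longrightarrow>
      (\<forall>act'. is_right_hopf_action U H act' \<and> action_dual_to_mult U H act' \<longrightarrow>
        (\<forall>D\<in>carrier U. \<forall>f\<in>carrier H. act' D f = act D f))) \<and>
    is_algebra (smash_product H U act) \<and>
    (let is_lambda = (\<lambda>lam. is_unital_antihom U (smash_product H U act) lam \<and>
        (\<forall>j\<in>{1..n}. lam (\<iota> (X j)) = (\<Sum>i=1..n. tens H U (Ub i j) (\<iota> (X i))))) in
      (\<exists>!lam. is_lambda lam) \<and>
      (\<forall>lam. is_lambda lam \<longrightarrow>
        is_yetter_drinfeld_module_algebra H U act lam \<and> is_braided_commutative H U act lam))"
proof -
  interpret E: enveloping_dual_action U S sg br \<iota> n X C Um Ub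
    using assms
    by unfold_locales
      (auto simp: is_enveloping_hopf_algebra_def is_universal_enveloping_def is_hopf_algebra_def)
  have lambda: "E.is_lambda lam \<longleftrightarrow> is_unital_antihom U (smash_product E.H U E.act) lam \<and>
      (\<forall>j\<in>{1..n}. lam (\<iota> (X j)) = (\<Sum>i=1..n. tens E.H U (Ub i j) (\<iota> (X i))))" for lam
    by (simp only: E.is_lambda_def E.coaction_generator_def)
  have "\<exists>!lam. E.is_lambda lam"
    using E.lambda_exists E.lambda_unique by blast
  moreover have "is_yetter_drinfeld_module_algebra E.H U E.act lam \<and> is_braided_commutative E.H U E.act lam"
    if "E.is_lambda lam" for lam
  proof -
    interpret R: regular_coaction E.H U E.act lam by (rule E.lambda_regular_coaction[OF that])
    show ?thesis using R.yetter_drinfeld_module_algebra R.braided_commutative by blast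
  qed
  moreover have "act' D f = E.act D f"
    if "nondegenerate_pairing U E.H" "is_right_hopf_action U E.H act'" "action_dual_to_mult U E.H act'"
      "f \<in> carrier E.H" for act' D f
    using E.dual_action_unique[OF that(1-3)] that(4) by (simp only: E.H_simps(1))
  ultimately show ?thesis
    using E.right_hopf_action E.action_dual E.faithful.smash_product_algebra
    unfolding Let_def lambda by blast
qed


end
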